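(* Let $K\subseteq\mathbb{R}^n$ be a convex body. Then $$\#(K)^{\frac{n-1}{n}}\leq O(n^2) \max_{\mathbf{t}\in\mathbb{Z}^n,\ \mathbf{u}\in\mathbb{Z}^n\setminus\{\mathbf{0}\}}\#\big(K\cap(\mathbf{t}+\mathbf{u}^\perp)\big).$$ If $K$ is origin-symmetric, the constant $O(n^2)$ can be replaced by $O(n)$.
   Context: A convex body in $\mathbb{R}^n$ is a compact convex set $K\subseteq\mathbb{R}^n$; it is origin-symmetric if $K=-K$. For $M\subseteq\mathbb{R}^n$, $\#(M)=|M\cap\mathbb{Z}^n|$ is the number of integer points in $M$. For $\mathbf{u}\neq\mathbf{0}$, $\mathbf{u}^\perp=\{\mathbf{x}\in\mathbb{R}^n:\langle\mathbf{x},\mathbf{u}\rangle=0\}$. $O(n^2)$ and $O(n)$ denote constants depending only on the dimension $n$ that are bounded by $Cn^2$ and $Cn$, respectively, with a universal constant $C>0$ (independent of $n$ and $K$). *)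

theory Defs
  imports "HOL-Analysis.Analysis" "HOL-Analysis.Finite_Function_Topology"
begin

text \<open>
  The constant in the theorem is uniform in the dimension, so the dimension has to be a number and
  not a type. \<open>\<real>\<^sup>n\<close> is therefore the subspace of those finitely supported sequences
  whose support lies in \<open>{..<n}\<close>. The library makes finitely supported functions a normed
  space, so \<^const>\<open>convex\<close> and \<^const>\<open>compact\<close> are the library notions. Its norm is the
  1-norm, see \<open>norm_Rn\<close> below; on \<open>\<real>\<^sup>n\<close> this gives the usual topology, and a subset of
  \<open>\<real>\<^sup>n\<close> is compact in the subspace iff it is compact in the ambient space.
\<close>

definition Rn :: "nat \<Rightarrow> (nat \<Rightarrow>\<^sub>0 real) set"
  where "Rn n = {x. Poly_Mapping.keys x \<subseteq> {..<n}}"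

definition Zn :: "nat \<Rightarrow> (nat \<Rightarrow>\<^sub>0 real) set"
  where "Zn n = {x \<in> Rn n. \<forall>i. Poly_Mapping.lookup x i \<in> \<int>}"

definition dot :: "nat \<Rightarrow> (nat \<Rightarrow>\<^sub>0 real) \<Rightarrow> (nat \<Rightarrow>\<^sub>0 real) \<Rightarrow> real"
  where "dot n x y = (\<Sum>i<n. Poly_Mapping.lookup x i * Poly_Mapping.lookup y i)"

definition orth :: "nat \<Rightarrow> (nat \<Rightarrow>\<^sub>0 real) \<Rightarrow> (nat \<Rightarrow>\<^sub>0 real) set"
  where "orth n u = {x \<in> Rn n. dot n x u = 0}"

text \<open>As in the source, a convex body may be empty or have empty interior.\<close>

definition convex_body :: "nat \<Rightarrow> (nat \<Rightarrow>\<^sub>0 real) set \<Rightarrow> bool"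
  where "convex_body n K \<longleftrightarrow> K \<subseteq> Rn n \<and> compact K \<and> convex K"

definition origin_symmetric :: "(nat \<Rightarrow>\<^sub>0 real) set \<Rightarrow> bool"
  where "origin_symmetric K \<longleftrightarrow> K = uminus ` K"

definition lattice_count :: "nat \<Rightarrow> (nat \<Rightarrow>\<^sub>0 real) set \<Rightarrow> nat"
  where "lattice_count n M = card (M \<inter> Zn n)"

definition slice_counts :: "nat \<Rightarrow> (nat \<Rightarrow>\<^sub>0 real) set \<Rightarrow> nat set"
  where "slice_counts n K =
    {lattice_count n (K \<inter> (\<lambda>x. t + x) ` orth n u) | t u. t \<in> Zn n \<and> u \<in> Zn n - {0}}"

definition max_slice_count :: "nat \<Rightarrow> (nat \<Rightarrow>\<^sub>0 real) set \<Rightarrow> nat"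
  where "max_slice_count n K = Max (slice_counts n K)"

text \<open>
  For a convex body all cardinalities above are those of finite sets, and for \<open>n \<ge> 1\<close> the maximum
  ranges over a finite nonempty set.
\<close>

lemma norm_Rn:
  assumes "x \<in> Rn n"
  shows "norm x = (\<Sum>i<n. \<bar>Poly_Mapping.lookup x i\<bar>)"
proof -
  have "norm x = (\<Sum>i\<in>Poly_Mapping.keys x. \<bar>Poly_Mapping.lookup x i\<bar>)"
    by (simp add: norm_poly_mapping_def dist_poly_mapping_def)
  also have "\<dots> = (\<Sum>i<n. \<bar>Poly_Mapping.lookup x i\<bar>)"
    using assms by (intro sum.mono_neutral_left) (auto simp: Rn_def in_keys_iff)
  finally show ?thesis .
qed

lemma finite_lattice_points:
  assumes "convex_body n K"
  shows "finite (K \<inter> Zn n)"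
proof -
  from assms have "bounded K"
    by (simp add: convex_body_def compact_imp_bounded)
  then obtain B where B: "\<And>x. x \<in> K \<Longrightarrow> norm x \<le> B"
    by (auto simp: bounded_iff)
  define Z where "Z = {z::real. z \<in> \<int> \<and> \<bar>z\<bar> \<le> B}"
  have fin: "finite Z"
    unfolding Z_def by (rule finite_abs_int_segment)
  have "Poly_Mapping.lookup ` (K \<inter> Zn n) \<subseteq> {f. \<forall>i. (i \<in> {..<n} \<longrightarrow> f i \<in> Z) \<and> (i \<notin> {..<n} \<longrightarrow> f i = 0)}"
  proof clarify
    fix x i assume x: "x \<in> K" "x \<in> Zn n"
    then have R: "x \<in> Rn n" by (simp add: Zn_def)
    have "\<bar>Poly_Mapping.lookup x i\<bar> \<le> B" if "i < n"
    proof -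
      have "\<bar>Poly_Mapping.lookup x i\<bar> \<le> (\<Sum>i<n. \<bar>Poly_Mapping.lookup x i\<bar>)"
        using that by (intro member_le_sum) auto
      then show ?thesis using B[OF x(1)] norm_Rn[OF R] by simp
    qed
    then show "(i \<in> {..<n} \<longrightarrow> Poly_Mapping.lookup x i \<in> Z) \<and>
        (i \<notin> {..<n} \<longrightarrow> Poly_Mapping.lookup x i = 0)"
      using x(2) R by (auto simp: Z_def Zn_def Rn_def in_keys_iff subset_iff)
  qed
  moreover have "finite {f. \<forall>i. (i \<in> {..<n} \<longrightarrow> f i \<in> Z) \<and> (i \<notin> {..<n} \<longrightarrow> f i = (0::real))}"
    using fin by (intro finite_set_of_finite_funs) auto
  ultimately have "finite (Poly_Mapping.lookup ` (K \<inter> Zn n))"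
    by (rule finite_subset)
  then show ?thesis
    by (rule finite_imageD) (auto simp: inj_on_def intro: poly_mapping_eqI)
qed

lemma finite_slice_counts:
  assumes "convex_body n K"
  shows "finite (slice_counts n K)"
proof (rule finite_subset)
  show "slice_counts n K \<subseteq> {..card (K \<inter> Zn n)}"
    by (auto simp: slice_counts_def lattice_count_def
        intro!: card_mono finite_lattice_points[OF assms])
qed simp

lemma slice_counts_nonempty:
  assumes "n \<ge> 1"
  shows "slice_counts n K \<noteq> {}"
proof -
  have "(0 :: nat \<Rightarrow>\<^sub>0 real) \<in> Zn n"
    by (simp add: Zn_def Rn_def)
  moreover have "Poly_Mapping.single 0 1 \<in> Zn n - {0}"
    using assms by (auto simp: Zn_def Rn_def lookup_one when_def)
  ultimately show ?thesis
    unfolding slice_counts_def by blast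
qed

end

theory Submission
  imports Defs
begin

text \<open>
  Let \<open>A\<close> be the set of the \<open>N\<close> lattice points of \<open>K\<close>. It suffices to find a nonzero integer vector
  \<open>u\<close> such that the standard deviation \<open>\<sigma> u\<close> of \<open>\<langle>x, u\<rangle>\<close> over \<open>x \<in> A\<close> is at most
  \<open>O(n\<^sup>2) N\<^bsup>1/n\<^esup>\<close>, respectively \<open>O(n) N\<^bsup>1/n\<^esup>\<close>: by Chebyshev's inequality most points then lie
  in that many slices. The form \<open>\<sigma>\<^sup>2\<close> is a Gram form, so Gram-Schmidt makes it triangular, and
  then Minkowski's theorem is an elementary pigeonhole argument.

  If \<open>K\<close> is symmetric, it contains the ellipsoid with support function \<open>\<sigma>\<close> (with \<open>\<sigma>\<close> taken about
  the origin). Counting lattice points in this ellipsoid bounds the determinant of \<open>\<sigma>\<^sup>2\<close> in terms of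
  \<open>N\<close>, and Minkowski's theorem yields \<open>u\<close>.

  In general only \<open>K - K\<close> contains that ellipsoid. If \<open>\<sigma> u \<ge> L\<close> for all nonzero integer \<open>u\<close>, a
  Korkine-Zolotarev type reduction produces vectors \<open>w j\<close> of dual norm at most \<open>4 n / L\<close> that span a
  box covering space modulo \<open>\<int>\<^sup>n\<close>. Every \<open>w j\<close> is, up to scaling, a difference of two points of
  \<open>K\<close>, so for \<open>L = 4 n\<^sup>2 k\<close> the body \<open>K\<close> contains a translate of the \<open>k\<close>-fold box. Hence it
  meets every residue class modulo \<open>k\<close>, and \<open>k\<^sup>n \<le> N\<close>.
\<close>

section \<open>Pigeonhole in triangular coordinates\<close>

text \<open>Integer vectors indexed by \<open>I\<close> are encoded as total functions vanishing off
  \<open>I\<close>, so distinct ones differ in a coordinate of \<open>I\<close>.\<close>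

definition int_pts :: "'i set \<Rightarrow> ('i \<Rightarrow> real) set"
  where "int_pts I = {x. (\<forall>i\<in>I. x i \<in> \<int>) \<and> (\<forall>i. i \<notin> I \<longrightarrow> x i = 0)}"

text \<open>
  The third clause says that the half-open unit boxes of the coordinates \<open>G\<close>, placed at the integer
  points, tile the space; the shift \<open>v\<close> is what makes it provable one coordinate at a time.
\<close>

definition triangular :: "'i set \<Rightarrow> (('i \<Rightarrow> real) \<Rightarrow> 'i \<Rightarrow> real) \<Rightarrow> bool"
  where "triangular I G \<longleftrightarrow>
    (\<forall>u v. \<forall>j\<in>I. G (\<lambda>i. u i - v i) j = G u j - G v j) \<and>
    (\<forall>u v. (\<forall>i\<in>I. u i = v i) \<longrightarrow> (\<forall>j\<in>I. G u j = G v j)) \<and>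
    (\<forall>v (s::'i \<Rightarrow> int). \<exists>x\<in>int_pts I. \<forall>j\<in>I. \<lfloor>G (\<lambda>i. x i + v i) j\<rfloor> = s j)"

lemma triangular_diff:
  "triangular I G \<Longrightarrow> j \<in> I \<Longrightarrow> G (\<lambda>i. u i - v i) j = G u j - G v j"
  by (simp add: triangular_def)

lemma triangular_cong:
  "triangular I G \<Longrightarrow> (\<And>i. i \<in> I \<Longrightarrow> u i = v i) \<Longrightarrow> j \<in> I \<Longrightarrow> G u j = G v j"
  unfolding triangular_def by blast

lemma triangular_floor:
  assumes "triangular I G"
  obtains x where "x \<in> int_pts I" "\<And>j. j \<in> I \<Longrightarrow> \<lfloor>G (\<lambda>i. x i + v i) j\<rfloor> = s j"
  using assms unfolding triangular_def by blast

lemma int_pts_diff: "x \<in> int_pts I \<Longrightarrow> y \<in> int_pts I \<Longrightarrow> (\<lambda>i. x i - y i) \<in> int_pts I"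
  by (auto simp: int_pts_def)

lemma card_le_fibers:
  assumes "finite X" "finite (g ` X)" "\<And>c. c \<in> g ` X \<Longrightarrow> card {x\<in>X. g x = c} \<le> m"
  shows "card X \<le> m * card (g ` X)"
proof -
  have "card X = (\<Sum>c\<in>g ` X. card {x\<in>X. g x = c})"
    using sum.image_gen[OF assms(1), of "\<lambda>_. 1::nat" g] by simp
  also have "\<dots> \<le> (\<Sum>c\<in>g ` X. m)"
    by (rule sum_mono) (use assms(3) in blast)
  finally show ?thesis by (simp add: mult.commute)
qed

text \<open>A discrete form of Blichfeldt's theorem. The tiling yields one integer point in each of
  \<open>Q ^ card I\<close> unit boxes. Sorting these points by cells of side \<open>T\<close> in
  the scaled coordinates \<open>l j * G x j\<close> uses roughly the fraction
  \<open>(\<Prod>j\<in>I. l j) / T ^ card I\<close> as many cells, so for large \<open>Q\<close>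
  some cell holds more than \<open>m\<close> points.\<close>

lemma triangular_blichfeldt:
  assumes fin: "finite I" and tri: "triangular I G" and l: "\<And>j. j \<in> I \<Longrightarrow> 0 \<le> l j"
    and T: "T > 0" and less: "real m * (\<Prod>j\<in>I. l j) < T ^ card I"
  obtains X where "X \<subseteq> int_pts I" "finite X" "m < card X"
    "\<And>x y j. x \<in> X \<Longrightarrow> y \<in> X \<Longrightarrow> j \<in> I \<Longrightarrow> l j * \<bar>G x j - G y j\<bar> < T"
proof -
  \<comment> \<open>The term \<open>1 / real Q\<close> is the rounding error of the cell count in
    one direction, relative to \<open>Q\<close>. It vanishes in the limit, where the inequality
    becomes the hypothesis, so a suitable finite \<open>Q\<close> exists.\<close>
  have "(\<lambda>Q::nat. real m * (\<Prod>j\<in>I. l j / T + 1 / real Q)) \<longlonglongrightarrow> real m * (\<Prod>j\<in>I. l j / T + 0)"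
    by (intro tendsto_intros lim_1_over_n)
  moreover have "real m * (\<Prod>j\<in>I. l j / T + 0) < 1"
    using less T by (simp add: prod_dividef divide_simps)
  ultimately have "eventually (\<lambda>Q::nat. real m * (\<Prod>j\<in>I. l j / T + 1 / real Q) < 1) sequentially"
    by (rule order_tendstoD)
  then have "eventually (\<lambda>Q::nat. real m * (\<Prod>j\<in>I. l j / T + 1 / real Q) < 1 \<and> Q > 0) sequentially"
    using eventually_gt_at_top[of 0] by (rule eventually_conj)
  then obtain Q :: nat where Q: "real m * (\<Prod>j\<in>I. l j / T + 1 / real Q) < 1" "Q > 0"
    by (auto dest: eventually_happens simp: trivial_limit_sequentially)
  have cells_less: "real m * (\<Prod>j\<in>I. l j * real Q / T + 1) < real Q ^ card I"
  proof -
    have "(\<Prod>j\<in>I. l j * real Q / T + 1) = (\<Prod>j\<in>I. real Q * (l j / T + 1 / real Q))"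
      using Q(2) by (intro prod.cong) (auto simp: algebra_simps)
    also have "\<dots> = real Q ^ card I * (\<Prod>j\<in>I. l j / T + 1 / real Q)"
      by (simp add: prod.distrib)
    finally have "real m * (\<Prod>j\<in>I. l j * real Q / T + 1) =
        real Q ^ card I * (real m * (\<Prod>j\<in>I. l j / T + 1 / real Q))" by simp
    also have "\<dots> < real Q ^ card I * 1"
      using Q by (intro mult_strict_left_mono) auto
    finally show ?thesis by simp
  qed
  define B where "B = PiE I (\<lambda>_. {0..<int Q})"
  have "\<forall>s. \<exists>x\<in>int_pts I. \<forall>j\<in>I. \<lfloor>G x j\<rfloor> = s j"
  proof
    fix s :: "'a \<Rightarrow> int"
    show "\<exists>x\<in>int_pts I. \<forall>j\<in>I. \<lfloor>G x j\<rfloor> = s j"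
      by (rule triangular_floor[OF tri, of "\<lambda>_. 0" s]) auto
  qed
  \<comment> \<open>\<open>P s\<close> is an integer point in the tile with index \<open>s\<close>.
    Distinct indices give distinct points because the floors recover \<open>s\<close>.\<close>
  then obtain P where P: "\<And>s. P s \<in> int_pts I" "\<And>s j. j \<in> I \<Longrightarrow> \<lfloor>G (P s) j\<rfloor> = s j"
    by metis
  have injP: "inj_on P B"
  proof (rule inj_onI)
    fix s t assume "s \<in> B" "t \<in> B" "P s = P t"
    then show "s = t" unfolding B_def by (intro PiE_ext[of s I _ t]) (auto simp flip: P(2))
  qed
  have finB: "finite B" unfolding B_def using fin by (intro finite_PiE) auto
  define X0 where "X0 = P ` B"
  have finX0: "finite X0" unfolding X0_def using finB by simp
  have cardX0: "card X0 = Q ^ card I"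
    unfolding X0_def using card_image[OF injP] by (simp add: B_def card_PiE fin)
  \<comment> \<open>\<open>g x\<close> is the cell of side \<open>T\<close> that contains the scaled
    coordinates of \<open>x\<close>. Two points with the same cell are less than \<open>T\<close>
    apart in each direction.\<close>
  define g where "g x = restrict (\<lambda>j. \<lfloor>l j * G x j / T\<rfloor>) I" for x
  define C where "C = PiE I (\<lambda>j. {0..\<lfloor>l j * real Q / T\<rfloor>})"
  have gX0: "g ` X0 \<subseteq> C"
  proof (clarsimp simp: X0_def C_def g_def PiE_iff)
    fix s j assume "s \<in> B" "j \<in> I"
    then have "0 \<le> \<lfloor>G (P s) j\<rfloor>" "\<lfloor>G (P s) j\<rfloor> < int Q" by (auto simp: B_def P PiE_iff)
    then have "0 \<le> G (P s) j" "G (P s) j \<le> real Q" by linarith+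
    with l[OF \<open>j \<in> I\<close>] T show "0 \<le> l j * G (P s) j / T \<and>
        \<lfloor>l j * G (P s) j / T\<rfloor> \<le> \<lfloor>l j * real Q / T\<rfloor>"
      by (auto intro!: floor_mono divide_right_mono mult_left_mono)
  qed
  have finC: "finite C" unfolding C_def using fin by (intro finite_PiE) auto
  have "real (card C) = (\<Prod>j\<in>I. real (nat (\<lfloor>l j * real Q / T\<rfloor> + 1)))"
    unfolding C_def by (simp add: card_PiE fin)
  also have "\<dots> \<le> (\<Prod>j\<in>I. l j * real Q / T + 1)"
  proof (rule prod_mono)
    fix j assume "j \<in> I"
    then have "0 \<le> l j * real Q / T" using l T by simp
    then show "0 \<le> real (nat (\<lfloor>l j * real Q / T\<rfloor> + 1)) \<and>
        real (nat (\<lfloor>l j * real Q / T\<rfloor> + 1)) \<le> l j * real Q / T + 1" by auto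
  qed
  finally have "real m * real (card C) < real Q ^ card I"
    using cells_less by (meson mult_left_mono of_nat_0_le_iff order_le_less_trans)
  then have small: "m * card C < card X0"
    unfolding cardX0 by (metis of_nat_less_iff of_nat_mult of_nat_power)
  have "\<exists>c\<in>g ` X0. m < card {x\<in>X0. g x = c}"
  proof (rule ccontr)
    assume "\<not> ?thesis"
    then have "card X0 \<le> m * card (g ` X0)"
      using finX0 by (intro card_le_fibers) auto
    also have "\<dots> \<le> m * card C" using card_mono[OF finC gX0] by simp
    finally show False using small by simp
  qed
  then obtain c where c: "m < card {x\<in>X0. g x = c}" by blast
  show thesis
  proof (rule that)
    show "{x\<in>X0. g x = c} \<subseteq> int_pts I" using P(1) by (auto simp: X0_def)
    show "finite {x\<in>X0. g x = c}" using finX0 by simp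
    show "m < card {x\<in>X0. g x = c}" by (rule c)
    fix x y j assume xy: "x \<in> {x\<in>X0. g x = c}" "y \<in> {x\<in>X0. g x = c}" and j: "j \<in> I"
    then have "g x j = g y j" by simp
    then have "\<lfloor>l j * G x j / T\<rfloor> = \<lfloor>l j * G y j / T\<rfloor>" using j by (simp add: g_def)
    then have "\<bar>l j * G x j / T - l j * G y j / T\<bar> < 1" by linarith
    also have "l j * G x j / T - l j * G y j / T = l j * (G x j - G y j) / T"
      by (simp add: right_diff_distrib diff_divide_distrib)
    finally show "l j * \<bar>G x j - G y j\<bar> < T"
      using T l[OF j] by (simp add: abs_mult)
  qed
qed

text \<open>With \<open>m = 1\<close> the pigeonhole gives two points, and their difference is the
  required vector. The product of the \<open>l j\<close> takes the place of the lattice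
  determinant.\<close>

lemma triangular_minkowski:
  assumes "finite I" "triangular I G" "\<And>j. j \<in> I \<Longrightarrow> 0 \<le> l j"
    and "T > 0" "(\<Prod>j\<in>I. l j) < T ^ card I"
  obtains x where "x \<in> int_pts I" "\<exists>i\<in>I. x i \<noteq> 0" "\<And>j. j \<in> I \<Longrightarrow> l j * \<bar>G x j\<bar> < T"
proof -
  obtain X where X: "X \<subseteq> int_pts I" "finite X" "1 < card X"
    "\<And>x y j. x \<in> X \<Longrightarrow> y \<in> X \<Longrightarrow> j \<in> I \<Longrightarrow> l j * \<bar>G x j - G y j\<bar> < T"
    using triangular_blichfeldt[where l = l and m = 1, OF assms(1-4)] assms(5) by auto
  then obtain x y where xy: "x \<in> X" "y \<in> X" "x \<noteq> y"
    by (metis One_nat_def card_le_Suc0_iff_eq leD)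
  show thesis
  proof (rule that)
    show int: "(\<lambda>i. x i - y i) \<in> int_pts I" using X(1) xy by (intro int_pts_diff) auto
    show "\<exists>i\<in>I. x i - y i \<noteq> 0"
    proof (rule ccontr)
      assume "\<not> ?thesis"
      moreover have "x \<in> int_pts I" "y \<in> int_pts I" using X(1) xy by auto
      ultimately have "x i = y i" for i
        by (cases "i \<in> I") (auto simp: int_pts_def)
      then show False using xy(3) by auto
    qed
    show "l j * \<bar>G (\<lambda>i. x i - y i) j\<bar> < T" if "j \<in> I" for j
      using X(4)[OF xy(1,2) that] by (simp add: triangular_diff[OF assms(2) that])
  qed
qed

section \<open>Gram-Schmidt orthogonalization\<close>

text \<open>The \<open>\<phi> i\<close> are used as vectors in the Euclidean space of functions on a
  finite set \<open>A\<close>. Integer coefficients \<open>u\<close> then give the lattice generated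
  by them.\<close>

definition comb :: "'i set \<Rightarrow> ('i \<Rightarrow> 'a \<Rightarrow> real) \<Rightarrow> ('i \<Rightarrow> real) \<Rightarrow> 'a \<Rightarrow> real"
  where "comb I \<phi> u a = (\<Sum>i\<in>I. u i * \<phi> i a)"

lemma comb_insert:
  "finite I \<Longrightarrow> p \<notin> I \<Longrightarrow> comb (insert p I) \<phi> u a = u p * \<phi> p a + comb I \<phi> u a"
  by (simp add: comb_def)

lemma comb_cong:
  "(\<And>i. i \<in> I \<Longrightarrow> u i = v i) \<Longrightarrow> comb I \<phi> u = comb I \<phi> v"
  by (auto simp: comb_def intro!: ext sum.cong)

lemma comb_add_scaled:
  "comb I \<phi> (\<lambda>i. u i + r * v i) a = comb I \<phi> u a + r * comb I \<phi> v a"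
  by (simp add: comb_def algebra_simps sum.distrib sum_distrib_left)

lemma comb_sum:
  "comb I \<phi> (\<lambda>i. \<Sum>j\<in>J. r j * e j i) a = (\<Sum>j\<in>J. r j * comb I \<phi> (e j) a)"
  unfolding comb_def
  by (simp add: sum_distrib_left sum_distrib_right mult.assoc) (rule sum.swap)

text \<open>The coordinate \<open>p\<close> is independent of the others, so \<open>x p\<close> is
  fixed first by rounding. Its effect on the remaining coordinates is a translation, which the shift
  in the definition of \<open>triangular\<close> absorbs.\<close>

lemma triangular_insert_first:
  assumes p: "p \<notin> I" and G: "triangular I G"
  shows "triangular (insert p I) (\<lambda>u j. if j = p then u p else G (\<lambda>i. u i + u p * c i) j)"
    (is "triangular _ ?G")
  unfolding triangular_def
proof (intro conjI allI ballI impI)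
  fix u v :: "'a \<Rightarrow> real" and j assume j: "j \<in> insert p I"
  show "?G (\<lambda>i. u i - v i) j = ?G u j - ?G v j"
  proof (cases "j = p")
    case False
    have "(\<lambda>i. u i - v i + (u p - v p) * c i) = (\<lambda>i. (u i + u p * c i) - (v i + v p * c i))"
      by (simp add: algebra_simps)
    with False j triangular_diff[OF G, of j "\<lambda>i. u i + u p * c i" "\<lambda>i. v i + v p * c i"]
    show ?thesis by simp
  qed simp
next
  fix u v :: "'a \<Rightarrow> real" and j assume "\<forall>i\<in>insert p I. u i = v i" "j \<in> insert p I"
  then show "?G u j = ?G v j" by (auto intro!: triangular_cong[OF G])
next
  fix v :: "'a \<Rightarrow> real" and s :: "'a \<Rightarrow> int"
  define t where "t = real_of_int (s p - \<lfloor>v p\<rfloor>)"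
  obtain x where x: "x \<in> int_pts I"
    "\<And>j. j \<in> I \<Longrightarrow> \<lfloor>G (\<lambda>i. x i + (v i + (t + v p) * c i)) j\<rfloor> = s j"
    using triangular_floor[OF G] by metis
  have "\<lfloor>t + v p\<rfloor> = s p" unfolding t_def by linarith
  show "\<exists>x\<in>int_pts (insert p I). \<forall>j\<in>insert p I. \<lfloor>?G (\<lambda>i. x i + v i) j\<rfloor> = s j"
  proof (intro bexI ballI)
    show "x(p := t) \<in> int_pts (insert p I)" using x(1) by (auto simp: int_pts_def t_def)
    fix j assume j: "j \<in> insert p I"
    show "\<lfloor>?G (\<lambda>i. (x(p := t)) i + v i) j\<rfloor> = s j"
    proof (cases "j = p")
      case True
      then show ?thesis using \<open>\<lfloor>t + v p\<rfloor> = s p\<close> by simp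
    next
      case False
      with j have jI: "j \<in> I" by simp
      have "G (\<lambda>i. (x(p := t)) i + v i + (t + v p) * c i) j =
          G (\<lambda>i. x i + (v i + (t + v p) * c i)) j"
        using p by (intro triangular_cong[OF G _ jI]) auto
      then show ?thesis using False x(2)[OF jI] by simp
    qed
  qed
qed

text \<open>The transposed situation: the coordinates in \<open>I\<close> ignore \<open>x p\<close>,
  so they are settled first, and \<open>x p\<close> is then rounded to correct the last
  coordinate.\<close>

lemma triangular_insert_last:
  assumes p: "p \<notin> I" and H: "triangular I H"
  shows "triangular (insert p I) (\<lambda>x j. if j = p then x p - (\<Sum>i\<in>I. x i * c i) else H x j)"
    (is "triangular _ ?H")
  unfolding triangular_def
proof (intro conjI allI ballI impI)
  fix u v :: "'a \<Rightarrow> real" and j assume j: "j \<in> insert p I"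
  then show "?H (\<lambda>i. u i - v i) j = ?H u j - ?H v j"
    by (auto simp: triangular_diff[OF H] left_diff_distrib sum_subtractf)
next
  fix u v :: "'a \<Rightarrow> real" and j assume "\<forall>i\<in>insert p I. u i = v i" "j \<in> insert p I"
  then show "?H u j = ?H v j" by (auto intro!: triangular_cong[OF H])
next
  fix v :: "'a \<Rightarrow> real" and s :: "'a \<Rightarrow> int"
  obtain x where x: "x \<in> int_pts I" "\<And>j. j \<in> I \<Longrightarrow> \<lfloor>H (\<lambda>i. x i + v i) j\<rfloor> = s j"
    using triangular_floor[OF H] by metis
  define t where "t = real_of_int (s p - \<lfloor>v p - (\<Sum>i\<in>I. (x i + v i) * c i)\<rfloor>)"
  show "\<exists>x\<in>int_pts (insert p I). \<forall>j\<in>insert p I. \<lfloor>?H (\<lambda>i. x i + v i) j\<rfloor> = s j"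
  proof (intro bexI ballI)
    show "x(p := t) \<in> int_pts (insert p I)" using x(1) by (auto simp: int_pts_def t_def)
    fix j assume j: "j \<in> insert p I"
    show "\<lfloor>?H (\<lambda>i. (x(p := t)) i + v i) j\<rfloor> = s j"
    proof (cases "j = p")
      case True
      have "(\<Sum>i\<in>I. ((x(p := t)) i + v i) * c i) = (\<Sum>i\<in>I. (x i + v i) * c i)"
        using p by (intro sum.cong) auto
      moreover have "\<lfloor>t + v p - (\<Sum>i\<in>I. (x i + v i) * c i)\<rfloor> = s p"
        unfolding t_def by linarith
      ultimately show ?thesis using True by simp
    next
      case False
      with j have jI: "j \<in> I" by simp
      have "H (\<lambda>i. (x(p := t)) i + v i) j = H (\<lambda>i. x i + v i) j"
        using p by (intro triangular_cong[OF H _ jI]) auto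
      then show ?thesis using False x(2)[OF jI] by simp
    qed
  qed
qed

lemma triangular_empty: "triangular {} G"
  by (auto simp: triangular_def int_pts_def intro!: exI[of _ "\<lambda>_. 0"])

text \<open>\<open>G\<close> gives coordinates in the orthogonalized system \<open>e\<close>, and
  \<open>H\<close> is the contragredient change of variables, which serves the dual lattice.
  Subtracting from a new vector \<open>\<phi> p\<close> its projection onto the old span changes
  \<open>u\<close> to \<open>u + u p * c\<close>. Keeping the pairing invariant forces
  \<open>x p\<close> to become \<open>x p\<close> minus the pairing of \<open>x\<close> with
  \<open>c\<close>. Hence \<open>G\<close> grows by \<open>triangular_insert_first\<close> and
  \<open>H\<close> by \<open>triangular_insert_last\<close>.\<close>

lemma gram_schmidt:
  fixes \<phi> :: "'i \<Rightarrow> 'a \<Rightarrow> real"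
  assumes A: "finite A" and "finite I"
  obtains G H e where "triangular I G" "triangular I H"
    "\<And>u a. comb I \<phi> u a = (\<Sum>j\<in>I. G u j * comb I \<phi> (e j) a)"
    "\<And>j k. j \<in> I \<Longrightarrow> k \<in> I \<Longrightarrow> j \<noteq> k \<Longrightarrow>
       (\<Sum>a\<in>A. comb I \<phi> (e j) a * comb I \<phi> (e k) a) = 0"
    "\<And>x u. (\<Sum>i\<in>I. x i * u i) = (\<Sum>j\<in>I. G u j * H x j)"
proof -
  have "\<exists>G H e. triangular I G \<and> triangular I H \<and>
    (\<forall>u a. comb I \<phi> u a = (\<Sum>j\<in>I. G u j * comb I \<phi> (e j) a)) \<and>
    (\<forall>j\<in>I. \<forall>k\<in>I. j \<noteq> k \<longrightarrow> (\<Sum>a\<in>A. comb I \<phi> (e j) a * comb I \<phi> (e k) a) = 0) \<and>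
    (\<forall>x u. (\<Sum>i\<in>I. x i * u i) = (\<Sum>j\<in>I. G u j * H x j))"
    using assms(2)
  proof (induction I)
    case empty
    then show ?case by (auto simp: triangular_empty comb_def)
  next
    case (insert p I)
    then obtain G H e where G: "triangular I G" and H: "triangular I H"
      and dec: "\<And>u a. comb I \<phi> u a = (\<Sum>j\<in>I. G u j * comb I \<phi> (e j) a)"
      and orth: "\<And>j k. j \<in> I \<Longrightarrow> k \<in> I \<Longrightarrow> j \<noteq> k \<Longrightarrow>
        (\<Sum>a\<in>A. comb I \<phi> (e j) a * comb I \<phi> (e k) a) = 0"
      and dual: "\<And>x u. (\<Sum>i\<in>I. x i * u i) = (\<Sum>j\<in>I. G u j * H x j)"
      by blast
    define \<psi> where "\<psi> j = comb I \<phi> (e j)" for j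
    \<comment> \<open>The projection coefficient of \<open>\<phi> p\<close> along
      \<open>\<psi> j\<close>. If \<open>\<psi> j\<close> vanishes on \<open>A\<close>, division by
      zero makes it 0, and the orthogonality below holds trivially.\<close>
    define \<kappa> where "\<kappa> j = (\<Sum>a\<in>A. \<phi> p a * \<psi> j a) / (\<Sum>a\<in>A. \<psi> j a * \<psi> j a)" for j
    define c where "c i = (\<Sum>j\<in>I. \<kappa> j * e j i)" for i
    have comb_c: "comb I \<phi> c a = (\<Sum>j\<in>I. \<kappa> j * \<psi> j a)" for a
      using comb_sum[of I \<phi> \<kappa> e I a] by (simp add: c_def[abs_def] \<psi>_def)
    define r where "r a = \<phi> p a - comb I \<phi> c a" for a
    have r_orth: "(\<Sum>a\<in>A. r a * \<psi> k a) = 0" if k: "k \<in> I" for k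
    proof -
      have "(\<Sum>a\<in>A. comb I \<phi> c a * \<psi> k a) = (\<Sum>a\<in>A. \<Sum>j\<in>I. \<kappa> j * (\<psi> j a * \<psi> k a))"
        by (simp add: comb_c sum_distrib_right mult.assoc)
      also have "\<dots> = (\<Sum>j\<in>I. \<kappa> j * (\<Sum>a\<in>A. \<psi> j a * \<psi> k a))"
        by (subst sum.swap) (simp add: sum_distrib_left)
      also have "\<dots> = (\<Sum>j\<in>I. if j = k then \<kappa> k * (\<Sum>a\<in>A. \<psi> k a * \<psi> k a) else 0)"
        using k orth by (intro sum.cong) (auto simp: \<psi>_def)
      also have "\<dots> = \<kappa> k * (\<Sum>a\<in>A. \<psi> k a * \<psi> k a)" using insert(1) k by simp
      also have "\<dots> = (\<Sum>a\<in>A. \<phi> p a * \<psi> k a)"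
      proof (cases "(\<Sum>a\<in>A. \<psi> k a * \<psi> k a) = 0")
        case True
        then have "\<forall>a\<in>A. \<psi> k a = 0" using A by (subst (asm) sum_nonneg_eq_0_iff) auto
        then show ?thesis by simp
      qed (simp add: \<kappa>_def)
      finally show ?thesis by (simp add: r_def left_diff_distrib sum_subtractf)
    qed
    define G' where "G' u j = (if j = p then u p else G (\<lambda>i. u i + u p * c i) j)" for u j
    define H' where "H' x j = (if j = p then x p - (\<Sum>i\<in>I. x i * c i) else H x j)" for x j
    \<comment> \<open>The new vector has coefficient 1 at \<open>p\<close> and \<open>- c\<close>
      elsewhere, so its combination is the remainder \<open>r\<close>. The old vectors are extended
      by 0.\<close>
    define e' where "e' j = (if j = p then (\<lambda>i. - c i)(p := 1) else (e j)(p := 0))" for j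
    have G': "triangular (insert p I) G'"
      unfolding G'_def[abs_def] by (rule triangular_insert_first[OF insert(2) G])
    have H': "triangular (insert p I) H'"
      unfolding H'_def[abs_def] by (rule triangular_insert_last[OF insert(2) H])
    have e'p: "comb (insert p I) \<phi> (e' p) = r"
    proof
      fix a
      have "comb I \<phi> ((\<lambda>i. - c i)(p := 1)) = comb I \<phi> (\<lambda>i. - c i)"
        using insert(2) by (intro comb_cong) auto
      moreover have "comb I \<phi> (\<lambda>i. - c i) a = - comb I \<phi> c a"
        by (simp add: comb_def sum_negf)
      ultimately show "comb (insert p I) \<phi> (e' p) a = r a"
        using insert(1,2) by (simp add: comb_insert e'_def r_def)
    qed
    have e'j: "comb (insert p I) \<phi> (e' j) = \<psi> j" if "j \<in> I" for j
    proof
      fix a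
      have "comb I \<phi> ((e j)(p := 0)) = comb I \<phi> (e j)"
        using insert(2) by (intro comb_cong) auto
      moreover have "j \<noteq> p" using that insert(2) by auto
      ultimately show "comb (insert p I) \<phi> (e' j) a = \<psi> j a"
        using insert(1,2) by (simp add: comb_insert e'_def \<psi>_def)
    qed
    have neq: "j \<noteq> p" if "j \<in> I" for j using that insert(2) by auto
    have dec': "comb (insert p I) \<phi> u a = (\<Sum>j\<in>insert p I. G' u j * comb (insert p I) \<phi> (e' j) a)"
      for u a
    proof -
      have "comb (insert p I) \<phi> u a = u p * \<phi> p a + comb I \<phi> u a"
        using insert(1,2) by (simp add: comb_insert)
      also have "\<dots> = u p * r a + comb I \<phi> (\<lambda>i. u i + u p * c i) a"
        unfolding comb_add_scaled r_def by (simp add: algebra_simps)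
      also have "\<dots> = u p * r a + (\<Sum>j\<in>I. G (\<lambda>i. u i + u p * c i) j * \<psi> j a)"
        unfolding \<psi>_def by (subst dec) simp
      finally show ?thesis
        using insert(1,2) by (simp add: e'p e'j G'_def neq cong: sum.cong)
    qed
    have dual': "(\<Sum>i\<in>insert p I. x i * u i) = (\<Sum>j\<in>insert p I. G' u j * H' x j)" for x u
    proof -
      have "(\<Sum>j\<in>I. G (\<lambda>i. u i + u p * c i) j * H x j) = (\<Sum>i\<in>I. x i * (u i + u p * c i))"
        by (rule dual[symmetric])
      also have "\<dots> = (\<Sum>i\<in>I. x i * u i) + u p * (\<Sum>i\<in>I. x i * c i)"
        by (simp add: algebra_simps sum.distrib sum_distrib_left)
      finally show ?thesis
        using insert(1,2) by (simp add: G'_def H'_def neq algebra_simps cong: sum.cong)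
    qed
    have orth': "(\<Sum>a\<in>A. comb (insert p I) \<phi> (e' j) a * comb (insert p I) \<phi> (e' k) a) = 0"
      if "j \<in> insert p I" "k \<in> insert p I" "j \<noteq> k" for j k
      using that r_orth orth by (auto simp: e'p e'j \<psi>_def mult.commute)
    show ?case
    proof (rule exI[of _ G'], rule exI[of _ H'], rule exI[of _ e'], intro conjI)
      show "triangular (insert p I) G'" by (fact G')
      show "triangular (insert p I) H'" by (fact H')
      show "\<forall>u a. comb (insert p I) \<phi> u a =
          (\<Sum>j\<in>insert p I. G' u j * comb (insert p I) \<phi> (e' j) a)"
        by (intro allI dec')
      show "\<forall>j\<in>insert p I. \<forall>k\<in>insert p I. j \<noteq> k \<longrightarrow>
          (\<Sum>a\<in>A. comb (insert p I) \<phi> (e' j) a * comb (insert p I) \<phi> (e' k) a) = 0"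
        by (intro ballI impI orth')
      show "\<forall>x u. (\<Sum>i\<in>insert p I. x i * u i) = (\<Sum>j\<in>insert p I. G' u j * H' x j)"
        by (intro allI dual')
    qed
  qed
  then obtain G H e where G: "triangular I G" and H: "triangular I H"
    and dec: "\<forall>u a. comb I \<phi> u a = (\<Sum>j\<in>I. G u j * comb I \<phi> (e j) a)"
    and orth: "\<forall>j\<in>I. \<forall>k\<in>I. j \<noteq> k \<longrightarrow> (\<Sum>a\<in>A. comb I \<phi> (e j) a * comb I \<phi> (e k) a) = 0"
    and dual: "\<forall>x u. (\<Sum>i\<in>I. x i * u i) = (\<Sum>j\<in>I. G u j * H x j)"
    by (elim exE conjE)
  show thesis
    by (rule that[OF G H dec[rule_format] orth[rule_format] dual[rule_format]])
qed

section \<open>Dual lattice and covering boxes\<close>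

definition sqnorm :: "'a set \<Rightarrow> ('a \<Rightarrow> real) \<Rightarrow> real"
  where "sqnorm A f = (\<Sum>a\<in>A. (f a)\<^sup>2)"

lemma sum_mult_orthogonal:
  fixes \<psi> :: "'i \<Rightarrow> 'a \<Rightarrow> real"
  assumes "finite I" and orth: "\<And>j k. j \<in> I \<Longrightarrow> k \<in> I \<Longrightarrow> j \<noteq> k \<Longrightarrow> (\<Sum>a\<in>A. \<psi> j a * \<psi> k a) = 0"
  shows "(\<Sum>a\<in>A. (\<Sum>j\<in>I. \<alpha> j * \<psi> j a) * (\<Sum>k\<in>I. \<beta> k * \<psi> k a)) =
    (\<Sum>j\<in>I. \<alpha> j * \<beta> j * sqnorm A (\<psi> j))"
proof -
  have "(\<Sum>a\<in>A. (\<Sum>j\<in>I. \<alpha> j * \<psi> j a) * (\<Sum>k\<in>I. \<beta> k * \<psi> k a)) =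
      (\<Sum>a\<in>A. \<Sum>j\<in>I. \<Sum>k\<in>I. \<alpha> j * \<beta> k * (\<psi> j a * \<psi> k a))"
    by (simp add: sum_product mult_ac)
  also have "\<dots> = (\<Sum>j\<in>I. \<Sum>k\<in>I. \<alpha> j * \<beta> k * (\<Sum>a\<in>A. \<psi> j a * \<psi> k a))"
    by (subst sum.swap, intro sum.cong refl, subst sum.swap) (simp add: sum_distrib_left)
  also have "\<dots> = (\<Sum>j\<in>I. \<Sum>k\<in>I. if k = j then \<alpha> j * \<beta> j * sqnorm A (\<psi> j) else 0)"
    using orth by (intro sum.cong) (auto simp: sqnorm_def power2_eq_square)
  finally show ?thesis using assms(1) by simp
qed

lemma sum_squares_le:
  fixes x :: "'i \<Rightarrow> real"
  assumes "\<And>j. j \<in> I \<Longrightarrow> \<bar>x j\<bar> < T"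
  shows "(\<Sum>j\<in>I. (x j)\<^sup>2) \<le> real (card I) * T\<^sup>2"
proof -
  have "(\<Sum>j\<in>I. (x j)\<^sup>2) \<le> (\<Sum>j\<in>I. T\<^sup>2)"
  proof (rule sum_mono)
    fix j assume "j \<in> I"
    then show "(x j)\<^sup>2 \<le> T\<^sup>2" using assms[of j] by (intro abs_le_square_iff[THEN iffD1]) auto
  qed
  then show ?thesis by simp
qed

text \<open>With \<open>l j\<close> the length of the j-th orthogonal vector the Gram form is a sum
  of squares, so the coordinatewise bounds of the pigeonhole become bounds on the form. The last two
  identities serve to construct functions on \<open>A\<close> with prescribed pairings and known
  norm.\<close>

lemma gram_schmidt_normalized:
  fixes \<phi> :: "'i \<Rightarrow> 'a \<Rightarrow> real"
  assumes A: "finite A" and I: "finite I"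
  obtains G H l \<psi> where "triangular I G" "triangular I H" "\<And>j. 0 \<le> l j"
    "\<And>u. sqnorm A (comb I \<phi> u) = (\<Sum>j\<in>I. (l j * G u j)\<^sup>2)"
    "\<And>x u. (\<Sum>i\<in>I. x i * u i) = (\<Sum>j\<in>I. G u j * H x j)"
    "\<And>\<alpha> u. (\<Sum>a\<in>A. (\<Sum>j\<in>I. \<alpha> j * \<psi> j a) * comb I \<phi> u a) = (\<Sum>j\<in>I. \<alpha> j * G u j * (l j)\<^sup>2)"
    "\<And>\<alpha>. sqnorm A (\<lambda>a. \<Sum>j\<in>I. \<alpha> j * \<psi> j a) = (\<Sum>j\<in>I. (\<alpha> j * l j)\<^sup>2)"
proof (rule gram_schmidt[OF assms, of \<phi>])
  fix G H e assume G: "triangular I G" and H: "triangular I H"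
    and dec: "\<And>u a. comb I \<phi> u a = (\<Sum>j\<in>I. G u j * comb I \<phi> (e j) a)"
    and orth: "\<And>j k. j \<in> I \<Longrightarrow> k \<in> I \<Longrightarrow> j \<noteq> k \<Longrightarrow>
       (\<Sum>a\<in>A. comb I \<phi> (e j) a * comb I \<phi> (e k) a) = 0"
    and dual: "\<And>x u. (\<Sum>i\<in>I. x i * u i) = (\<Sum>j\<in>I. G u j * H x j)"
  define \<psi> where "\<psi> j = comb I \<phi> (e j)" for j
  define l where "l j = sqrt (sqnorm A (\<psi> j))" for j
  have l2: "(l j)\<^sup>2 = sqnorm A (\<psi> j)" for j
    by (simp add: l_def sqnorm_def sum_nonneg)
  have ip: "(\<Sum>a\<in>A. (\<Sum>j\<in>I. \<alpha> j * \<psi> j a) * (\<Sum>j\<in>I. \<beta> j * \<psi> j a)) =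
      (\<Sum>j\<in>I. \<alpha> j * \<beta> j * (l j)\<^sup>2)" for \<alpha> \<beta>
    unfolding l2 using I orth by (intro sum_mult_orthogonal) (auto simp: \<psi>_def)
  have sq: "sqnorm A (\<lambda>a. \<Sum>j\<in>I. \<alpha> j * \<psi> j a) = (\<Sum>j\<in>I. (\<alpha> j * l j)\<^sup>2)" for \<alpha>
    unfolding sqnorm_def power2_eq_square ip by (simp add: power2_eq_square mult_ac)
  have dec': "comb I \<phi> u = (\<lambda>a. \<Sum>j\<in>I. G u j * \<psi> j a)" for u
    by (rule ext, subst dec) (simp add: \<psi>_def)
  show thesis
  proof (rule that[OF G H])
    show "0 \<le> l j" for j by (simp add: l_def sqnorm_def sum_nonneg)
    show "sqnorm A (comb I \<phi> u) = (\<Sum>j\<in>I. (l j * G u j)\<^sup>2)" for u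
      unfolding dec' sq by (simp add: mult.commute)
  qed (use dual ip sq in \<open>auto simp: dec'\<close>)
qed

text \<open>
  Pairing with \<open>f\<close> is integral on the lattice spanned by the \<open>\<phi> i\<close>, so \<open>f\<close> represents a vector of
  the dual lattice; applying Minkowski's argument to both lattices bounds the product of their
  first minima linearly in the rank.
\<close>

lemma dual_short_vector:
  fixes \<phi> :: "'i \<Rightarrow> 'a \<Rightarrow> real"
  assumes A: "finite A" and I: "finite I" "I \<noteq> {}" and L: "L > 0"
    and min: "\<And>u. u \<in> int_pts I \<Longrightarrow> \<exists>i\<in>I. u i \<noteq> 0 \<Longrightarrow> L\<^sup>2 \<le> sqnorm A (comb I \<phi> u)"
  obtains f where "sqnorm A f \<le> (4 * real (card I) / L)\<^sup>2"
    "\<And>i. i \<in> I \<Longrightarrow> (\<Sum>a\<in>A. f a * \<phi> i a) \<in> \<int>" "\<exists>i\<in>I. (\<Sum>a\<in>A. f a * \<phi> i a) \<noteq> 0"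
proof (rule gram_schmidt_normalized[OF A I(1), of \<phi>])
  fix G H l \<psi> assume G: "triangular I G" and H: "triangular I H" and l: "\<And>j. 0 \<le> l j"
    and sq: "\<And>u. sqnorm A (comb I \<phi> u) = (\<Sum>j\<in>I. (l j * G u j)\<^sup>2)"
    and dual: "\<And>x u. (\<Sum>i\<in>I. x i * u i) = (\<Sum>j\<in>I. G u j * H x j)"
    and ip: "\<And>\<alpha> u. (\<Sum>a\<in>A. (\<Sum>j\<in>I. \<alpha> j * \<psi> j a) * comb I \<phi> u a) = (\<Sum>j\<in>I. \<alpha> j * G u j * (l j)\<^sup>2)"
    and sq': "\<And>\<alpha>. sqnorm A (\<lambda>a. \<Sum>j\<in>I. \<alpha> j * \<psi> j a) = (\<Sum>j\<in>I. (\<alpha> j * l j)\<^sup>2)"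
  define d where "d = real (card I)"
  have d: "d > 0" using I by (simp add: d_def card_gt_0_iff)
  \<comment> \<open>If the product were smaller, Minkowski's argument would give a nonzero
    \<open>u\<close> with all coordinates below \<open>L / (2 * sqrt d)\<close>, whose squared norm
    is at most \<open>L\<^sup>2 / 4\<close>, against the assumed minimum.\<close>
  have prod_ge: "(L / (2 * sqrt d)) ^ card I \<le> (\<Prod>j\<in>I. l j)"
  proof (rule ccontr)
    assume "\<not> ?thesis"
    then obtain u where u: "u \<in> int_pts I" "\<exists>i\<in>I. u i \<noteq> 0"
      "\<And>j. j \<in> I \<Longrightarrow> l j * \<bar>G u j\<bar> < L / (2 * sqrt d)"
      using triangular_minkowski[OF I(1) G, of l "L / (2 * sqrt d)"] l L d by auto
    have "sqnorm A (comb I \<phi> u) \<le> d * (L / (2 * sqrt d))\<^sup>2"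
      unfolding sq d_def by (rule sum_squares_le) (use u(3) l in \<open>simp add: abs_mult d_def\<close>)
    also have "\<dots> = L\<^sup>2 / 4" using d by (simp add: power_divide power_mult_distrib)
    also have "\<dots> < L\<^sup>2" using L by simp
    finally show False using min[OF u(1,2)] by simp
  qed
  have "0 < (L / (2 * sqrt d)) ^ card I" using L d by simp
  then have "0 < (\<Prod>j\<in>I. l j)" using prod_ge by linarith
  then have lpos: "l j > 0" if "j \<in> I" for j
    using that l[of j] I(1) by (metis less_irrefl order_le_less prod_zero)
  then have lne: "l j \<noteq> 0" if "j \<in> I" for j using that by (simp add: less_imp_neq[symmetric])
  have "(\<Prod>j\<in>I. 1 / l j) = 1 / (\<Prod>j\<in>I. l j)" by (simp add: prod_dividef)
  also have "\<dots> \<le> 1 / (L / (2 * sqrt d)) ^ card I"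
    using prod_ge L d by (intro divide_left_mono) (auto intro!: mult_pos_pos \<open>0 < (\<Prod>j\<in>I. l j)\<close>)
  also have "\<dots> = (2 * sqrt d / L) ^ card I" by (simp add: power_divide)
  \<comment> \<open>Doubling 2 to 4 supplies the strict inequality that the pigeonhole
    requires.\<close>
  also have "\<dots> < (4 * sqrt d / L) ^ card I"
    using L d I by (intro power_strict_mono divide_strict_right_mono) (auto simp: card_gt_0_iff)
  finally obtain x where x: "x \<in> int_pts I" "\<exists>i\<in>I. x i \<noteq> 0"
      "\<And>j. j \<in> I \<Longrightarrow> 1 / l j * \<bar>H x j\<bar> < 4 * sqrt d / L"
    using triangular_minkowski[OF I(1) H, of "\<lambda>j. 1 / l j" "4 * sqrt d / L"] l L d by auto
  \<comment> \<open>The weights \<open>1 / (l j)\<^sup>2\<close> cancel the squared lengths in the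
    inner product. Pairing \<open>f\<close> with \<open>comb I \<phi> u\<close> therefore gives the
    pairing of \<open>x\<close> with \<open>u\<close>, and the unit vectors \<open>u\<close> give
    the coordinates of \<open>x\<close>.\<close>
  define f where "f a = (\<Sum>j\<in>I. (H x j / (l j)\<^sup>2) * \<psi> j a)" for a
  have f: "(\<Sum>a\<in>A. f a * \<phi> i a) = x i" if i: "i \<in> I" for i
  proof -
    define u where "u k = (if k = i then 1 else 0 :: real)" for k
    have "comb I \<phi> u a = \<phi> i a" for a
      using i I(1) by (simp add: comb_def u_def if_distrib[of "\<lambda>t. t * _"] cong: if_cong)
    then have "(\<Sum>a\<in>A. f a * \<phi> i a) = (\<Sum>j\<in>I. H x j / (l j)\<^sup>2 * G u j * (l j)\<^sup>2)"
      using ip[of "\<lambda>j. H x j / (l j)\<^sup>2" u] by (simp add: f_def)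
    also have "\<dots> = (\<Sum>j\<in>I. G u j * H x j)"
      using lne by (intro sum.cong) simp_all
    also have "\<dots> = (\<Sum>k\<in>I. x k * u k)" by (rule dual[symmetric])
    also have "\<dots> = x i" using i I(1) by (simp add: u_def if_distrib cong: if_cong)
    finally show ?thesis .
  qed
  show thesis
  proof (rule that)
    have "sqnorm A f = (\<Sum>j\<in>I. (H x j / l j)\<^sup>2)"
      unfolding f_def sq' using lne by (intro sum.cong) (simp_all add: power2_eq_square)
    also have "\<dots> \<le> d * (4 * sqrt d / L)\<^sup>2"
      unfolding d_def by (rule sum_squares_le) (use x(3) l in \<open>simp add: d_def abs_divide\<close>)
    also have "\<dots> = (4 * d / L)\<^sup>2"
      using d by (simp add: power_divide power_mult_distrib) (simp add: power2_eq_square)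
    finally show "sqnorm A f \<le> (4 * real (card I) / L)\<^sup>2" by (simp add: d_def)
    show "(\<Sum>a\<in>A. f a * \<phi> i a) \<in> \<int>" if "i \<in> I" for i
      using that x(1) by (simp add: f int_pts_def)
    show "\<exists>i\<in>I. (\<Sum>a\<in>A. f a * \<phi> i a) \<noteq> 0" using x(2) f by auto
  qed
qed

text \<open>
  The sides \<open>w j = (\<lambda>i. \<Sum>a\<in>A. f j a * \<phi> i a)\<close> of the covering box are given by
  representatives \<open>f j\<close>, because these still make sense, with the same norm, when a further
  coordinate is added; this replaces an extension argument for functionals.
\<close>

definition box_covers :: "real \<Rightarrow> 'a set \<Rightarrow> ('i \<Rightarrow> 'a \<Rightarrow> real) \<Rightarrow> 'i set \<Rightarrow> bool"
  where "box_covers c A \<phi> I \<longleftrightarrow> (\<exists>f. (\<forall>j\<in>I. sqnorm A (f j) \<le> c\<^sup>2) \<and>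
    (\<forall>y. \<exists>z\<in>int_pts I. \<exists>\<theta>. (\<forall>j\<in>I. 0 \<le> \<theta> j \<and> \<theta> j \<le> 1) \<and>
      (\<forall>i\<in>I. y i = z i + (\<Sum>j\<in>I. \<theta> j * (\<Sum>a\<in>A. f j a * \<phi> i a)))))"

definition min_ge :: "real \<Rightarrow> 'a set \<Rightarrow> ('i \<Rightarrow> 'a \<Rightarrow> real) \<Rightarrow> 'i set \<Rightarrow> bool"
  where "min_ge L A \<phi> I \<longleftrightarrow>
    (\<forall>u\<in>int_pts I. (\<exists>i\<in>I. u i \<noteq> 0) \<longrightarrow> L\<^sup>2 \<le> sqnorm A (comb I \<phi> u))"

lemma min_ge_diff:
  assumes "finite I" "p \<in> I" "min_ge L A \<phi> I"
  shows "min_ge L A \<phi> (I - {p})"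
  unfolding min_ge_def
proof (intro ballI impI)
  fix u assume u: "u \<in> int_pts (I - {p})" "\<exists>i\<in>I - {p}. u i \<noteq> 0"
  then have "u \<in> int_pts I" "u p = 0" by (force simp: int_pts_def)+
  moreover have "comb I \<phi> u = comb (I - {p}) \<phi> u"
    using assms(1,2) \<open>u p = 0\<close> by (intro ext) (simp add: comb_def sum.remove)
  ultimately show "L\<^sup>2 \<le> sqnorm A (comb (I - {p}) \<phi> u)"
    using assms(3) u(2) unfolding min_ge_def by (metis DiffD1)
qed

text \<open>The side given by \<open>g\<close> is the unit vector in direction \<open>p\<close>. The
  other coordinates are covered first by hypothesis, and moving along this side repairs coordinate
  \<open>p\<close> without disturbing them.\<close>

lemma box_covers_insert:
  fixes \<phi> :: "'i \<Rightarrow> 'a \<Rightarrow> real"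
  assumes I: "finite I" and p: "p \<in> I"
    and g: "sqnorm A g \<le> c\<^sup>2" "(\<Sum>a\<in>A. g a * \<phi> p a) = 1"
      "\<And>i. i \<in> I - {p} \<Longrightarrow> (\<Sum>a\<in>A. g a * \<phi> i a) = 0"
    and cov: "box_covers c A \<phi> (I - {p})"
  shows "box_covers c A \<phi> I"
proof -
  obtain f where f: "\<And>j. j \<in> I - {p} \<Longrightarrow> sqnorm A (f j) \<le> c\<^sup>2"
    and cover: "\<And>y. \<exists>z\<in>int_pts (I - {p}). \<exists>\<theta>. (\<forall>j\<in>I - {p}. 0 \<le> \<theta> j \<and> \<theta> j \<le> 1) \<and>
      (\<forall>i\<in>I - {p}. y i = z i + (\<Sum>j\<in>I - {p}. \<theta> j * (\<Sum>a\<in>A. f j a * \<phi> i a)))"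
    using cov unfolding box_covers_def by blast
  show ?thesis
    unfolding box_covers_def
  proof (intro exI[of _ "f(p := g)"] conjI ballI allI)
    show "sqnorm A ((f(p := g)) j) \<le> c\<^sup>2" if "j \<in> I" for j using that f g(1) by simp
    fix y :: "'i \<Rightarrow> real"
    obtain z \<theta> where z: "z \<in> int_pts (I - {p})"
      and \<theta>: "\<And>j. j \<in> I - {p} \<Longrightarrow> 0 \<le> \<theta> j \<and> \<theta> j \<le> 1"
      and y: "\<And>i. i \<in> I - {p} \<Longrightarrow> y i = z i + (\<Sum>j\<in>I - {p}. \<theta> j * (\<Sum>a\<in>A. f j a * \<phi> i a))"
      using cover[of y] by blast
    \<comment> \<open>The error left in coordinate \<open>p\<close>: its integer part goes into the
      lattice point, its fractional part becomes the coefficient of the new side.\<close>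
    define t where "t = y p - (\<Sum>j\<in>I - {p}. \<theta> j * (\<Sum>a\<in>A. f j a * \<phi> p a))"
    have split: "(\<Sum>j\<in>I. (\<theta>(p := frac t)) j * (\<Sum>a\<in>A. (f(p := g)) j a * \<phi> i a)) =
        frac t * (\<Sum>a\<in>A. g a * \<phi> i a) + (\<Sum>j\<in>I - {p}. \<theta> j * (\<Sum>a\<in>A. f j a * \<phi> i a))" for i
      using I p by (simp add: sum.remove)
    show "\<exists>z\<in>int_pts I. \<exists>\<theta>. (\<forall>j\<in>I. 0 \<le> \<theta> j \<and> \<theta> j \<le> 1) \<and>
      (\<forall>i\<in>I. y i = z i + (\<Sum>j\<in>I. \<theta> j * (\<Sum>a\<in>A. (f(p := g)) j a * \<phi> i a)))"
    proof (intro bexI exI conjI ballI)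
      show "z(p := of_int \<lfloor>t\<rfloor>) \<in> int_pts I" using z p by (auto simp: int_pts_def)
      show "0 \<le> (\<theta>(p := frac t)) j" "(\<theta>(p := frac t)) j \<le> 1" if "j \<in> I" for j
        using \<theta> that by (auto simp: less_imp_le[OF frac_lt_1])
      show "y i = (z(p := of_int \<lfloor>t\<rfloor>)) i +
          (\<Sum>j\<in>I. (\<theta>(p := frac t)) j * (\<Sum>a\<in>A. (f(p := g)) j a * \<phi> i a))" if "i \<in> I" for i
        unfolding split using that y g by (cases "i = p") (auto simp: t_def frac_def)
    qed
  qed
qed

text \<open>An elementary unimodular change of basis leaves the lattice unchanged: the integer
  combination \<open>u\<close> of the new vectors is the combination \<open>v\<close> of the old
  ones.\<close>

lemma min_ge_shear:
  fixes \<phi> :: "'i \<Rightarrow> 'a \<Rightarrow> real"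
  assumes I: "finite I" "i \<in> I" "k \<in> I" "i \<noteq> k" and \<epsilon>: "\<epsilon> \<in> \<int>" and min: "min_ge L A \<phi> I"
  shows "min_ge L A (\<phi>(i := \<lambda>a. \<phi> i a - \<epsilon> * \<phi> k a)) I"
  unfolding min_ge_def
proof (intro ballI impI)
  fix u assume u: "u \<in> int_pts I" "\<exists>i\<in>I. u i \<noteq> 0"
  define v where "v = u(k := u k - \<epsilon> * u i)"
  have "v \<in> int_pts I" using u(1) I \<epsilon> by (auto simp: v_def int_pts_def)
  moreover have "\<exists>i\<in>I. v i \<noteq> 0"
  proof (cases "u i = 0")
    case True
    then have "v = u" by (simp add: v_def)
    then show ?thesis using u(2) by simp
  next
    case False
    then have "v i \<noteq> 0" using I by (simp add: v_def)
    then show ?thesis using I by blast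
  qed
  moreover have "comb I (\<phi>(i := \<lambda>a. \<phi> i a - \<epsilon> * \<phi> k a)) u = comb I \<phi> v"
  proof
    fix a
    have "comb I \<phi>' w a = w i * \<phi>' i a + (w k * \<phi>' k a + comb (I - {i} - {k}) \<phi>' w a)"
      for w and \<phi>' :: "'i \<Rightarrow> 'a \<Rightarrow> real"
      using I by (simp add: comb_def sum.remove[of I i] sum.remove[of "I - {i}" k])
    moreover have "comb (I - {i} - {k}) (\<phi>(i := \<lambda>a. \<phi> i a - \<epsilon> * \<phi> k a)) u a =
        comb (I - {i} - {k}) \<phi> v a"
      unfolding comb_def v_def by (rule sum.cong) auto
    ultimately show "comb I (\<phi>(i := \<lambda>a. \<phi> i a - \<epsilon> * \<phi> k a)) u a = comb I \<phi> v a"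
      using I by (simp add: v_def algebra_simps)
  qed
  ultimately show "L\<^sup>2 \<le> sqnorm A (comb I (\<phi>(i := \<lambda>a. \<phi> i a - \<epsilon> * \<phi> k a)) u)"
    using min unfolding min_ge_def by simp
qed

text \<open>The representatives \<open>f j\<close> stay the same, since the shear acts on the box
  only through its coordinates. The sheared target is covered and the shear, an integral map, is
  undone.\<close>

lemma box_covers_shear:
  fixes \<phi> :: "'i \<Rightarrow> 'a \<Rightarrow> real"
  assumes I: "finite I" "i \<in> I" "k \<in> I" "i \<noteq> k" and \<epsilon>: "\<epsilon> \<in> \<int>"
    and cov: "box_covers c A (\<phi>(i := \<lambda>a. \<phi> i a - \<epsilon> * \<phi> k a)) I" (is "box_covers c A ?\<phi> I")
  shows "box_covers c A \<phi> I"
proof -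
  obtain f where f: "\<And>j. j \<in> I \<Longrightarrow> sqnorm A (f j) \<le> c\<^sup>2"
    and cover: "\<And>y. \<exists>z\<in>int_pts I. \<exists>\<theta>. (\<forall>j\<in>I. 0 \<le> \<theta> j \<and> \<theta> j \<le> 1) \<and>
      (\<forall>m\<in>I. y m = z m + (\<Sum>j\<in>I. \<theta> j * (\<Sum>a\<in>A. f j a * ?\<phi> m a)))"
    using cov unfolding box_covers_def by blast
  show ?thesis
    unfolding box_covers_def
  proof (intro exI[of _ f] conjI ballI allI)
    show "sqnorm A (f j) \<le> c\<^sup>2" if "j \<in> I" for j using that f by simp
    fix y :: "'i \<Rightarrow> real"
    obtain z \<theta> where z: "z \<in> int_pts I"
      and \<theta>: "\<And>j. j \<in> I \<Longrightarrow> 0 \<le> \<theta> j \<and> \<theta> j \<le> 1"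
      and y: "\<And>m. m \<in> I \<Longrightarrow> (y(i := y i - \<epsilon> * y k)) m =
        z m + (\<Sum>j\<in>I. \<theta> j * (\<Sum>a\<in>A. f j a * ?\<phi> m a))"
      using cover[of "y(i := y i - \<epsilon> * y k)"] by blast
    have "(\<Sum>j\<in>I. \<theta> j * (\<Sum>a\<in>A. f j a * ?\<phi> i a)) =
        (\<Sum>j\<in>I. \<theta> j * (\<Sum>a\<in>A. f j a * \<phi> i a)) - \<epsilon> * (\<Sum>j\<in>I. \<theta> j * (\<Sum>a\<in>A. f j a * \<phi> k a))"
      by (simp add: right_diff_distrib sum_subtractf sum_distrib_left mult_ac)
    then have yi: "y i = z i + \<epsilon> * z k + (\<Sum>j\<in>I. \<theta> j * (\<Sum>a\<in>A. f j a * \<phi> i a))"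
      using y[OF I(2)] y[OF I(3)] I(4) by (simp add: algebra_simps)
    show "\<exists>z\<in>int_pts I. \<exists>\<theta>. (\<forall>j\<in>I. 0 \<le> \<theta> j \<and> \<theta> j \<le> 1) \<and>
      (\<forall>m\<in>I. y m = z m + (\<Sum>j\<in>I. \<theta> j * (\<Sum>a\<in>A. f j a * \<phi> m a)))"
    proof (intro bexI exI conjI ballI)
      show "z(i := z i + \<epsilon> * z k) \<in> int_pts I" using z I \<epsilon> by (auto simp: int_pts_def)
      show "0 \<le> \<theta> j" "\<theta> j \<le> 1" if "j \<in> I" for j using \<theta>[OF that] by auto
      show "y m = (z(i := z i + \<epsilon> * z k)) m + (\<Sum>j\<in>I. \<theta> j * (\<Sum>a\<in>A. f j a * \<phi> m a))"
        if "m \<in> I" for m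
        using y[OF that] yi by (cases "m = i") auto
    qed
  qed
qed

text \<open>
  Euclid's algorithm on the coordinates \<open>b\<close> of the dual vector turns it into a multiple of a unit
  vector, whose coordinate is then split off.
\<close>

lemma box_covers_step:
  fixes \<phi> :: "'i \<Rightarrow> 'a \<Rightarrow> real"
  assumes I: "finite I"
    and IH: "\<And>p \<phi>. p \<in> I \<Longrightarrow> min_ge L A \<phi> (I - {p}) \<Longrightarrow> box_covers c A \<phi> (I - {p})"
    and "min_ge L A \<phi> I" and f: "sqnorm A f \<le> c\<^sup>2"
    and "\<And>i. i \<in> I \<Longrightarrow> (\<Sum>a\<in>A. f a * \<phi> i a) = real_of_int (b i)" "\<exists>i\<in>I. b i \<noteq> 0"
  shows "box_covers c A \<phi> I"
  using assms(3,5,6)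
proof (induction "\<Sum>i\<in>I. nat \<bar>b i\<bar>" arbitrary: b \<phi> rule: less_induct)
  case less
  obtain p where p: "p \<in> I" "b p \<noteq> 0" using less.prems by blast
  show ?case
  proof (cases "\<forall>i\<in>I - {p}. b i = 0")
    case True
    \<comment> \<open>Only \<open>b p\<close> is nonzero, so dividing by it gives the pairings 1 and
      0 that \<open>box_covers_insert\<close> needs. As \<open>b p\<close> is a nonzero integer, the
      norm does not grow.\<close>
    define g where "g a = f a / b p" for a
    have gsum: "(\<Sum>a\<in>A. g a * \<phi> i a) = b i / b p" if "i \<in> I" for i
      using less.prems(2)[OF that] by (simp add: g_def flip: sum_divide_distrib)
    have "1 \<le> \<bar>real_of_int (b p)\<bar>" using p by linarith
    then have ge1: "1 \<le> (real_of_int (b p))\<^sup>2"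
      by (metis one_le_power power2_abs)
    have "sqnorm A g = sqnorm A f / (b p)\<^sup>2"
      by (simp add: sqnorm_def g_def power_divide sum_divide_distrib)
    also have "\<dots> \<le> sqnorm A f"
      using frac_le[of "sqnorm A f" "sqnorm A f" 1 "(real_of_int (b p))\<^sup>2"] ge1
      by (simp add: sqnorm_def sum_nonneg)
    finally have "sqnorm A g \<le> c\<^sup>2" using f by simp
    then show ?thesis
      using I p True IH[OF p(1) min_ge_diff[OF I p(1) less.prems(1)]]
      by - (rule box_covers_insert[of I p A g], simp_all add: gsum)
  next
    case False
    then obtain q where q: "q \<in> I" "q \<noteq> p" "b q \<noteq> 0" by blast
    obtain i k where ik: "i \<in> I" "k \<in> I" "i \<noteq> k" "b k \<noteq> 0" "b i \<noteq> 0" "\<bar>b k\<bar> \<le> \<bar>b i\<bar>"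
      using p q by (metis linear)
    \<comment> \<open>With this sign, subtracting \<open>\<epsilon> * b k\<close> lowers the
      absolute value of \<open>b i\<close> by that of \<open>b k\<close>.\<close>
    define \<epsilon> where "\<epsilon> = sgn (b i) * sgn (b k)"
    define b' where "b' = b(i := b i - \<epsilon> * b k)"
    define \<phi>' where "\<phi>' = \<phi>(i := \<lambda>a. \<phi> i a - real_of_int \<epsilon> * \<phi> k a)"
    have small: "nat \<bar>b' i\<bar> < nat \<bar>b i\<bar>"
      using ik by (auto simp: b'_def \<epsilon>_def sgn_if split: if_splits)
    have "(\<Sum>i\<in>I. nat \<bar>b' i\<bar>) < (\<Sum>i\<in>I. nat \<bar>b i\<bar>)"
    proof (rule sum_strict_mono_ex1)
      show "\<forall>x\<in>I. nat \<bar>b' x\<bar> \<le> nat \<bar>b x\<bar>" using small by (auto simp: b'_def)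
      show "\<exists>a\<in>I. nat \<bar>b' a\<bar> < nat \<bar>b a\<bar>" using small ik by blast
    qed (use I in auto)
    moreover have "min_ge L A \<phi>' I"
      unfolding \<phi>'_def using ik(1-3) I less.prems(1) by - (rule min_ge_shear, simp_all)
    moreover have "(\<Sum>a\<in>A. f a * \<phi>' j a) = real_of_int (b' j)" if "j \<in> I" for j
    proof (cases "j = i")
      case True
      have "(\<Sum>a\<in>A. f a * \<phi>' i a) = (\<Sum>a\<in>A. f a * \<phi> i a) - \<epsilon> * (\<Sum>a\<in>A. f a * \<phi> k a)"
        by (simp add: \<phi>'_def right_diff_distrib sum_subtractf sum_distrib_left mult_ac)
      then show ?thesis using True less.prems(2) ik by (simp add: b'_def)
    next
      case False
      then show ?thesis using less.prems(2)[OF that] by (simp add: b'_def \<phi>'_def)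
    qed
    moreover have "\<exists>j\<in>I. b' j \<noteq> 0"
      using ik by (intro bexI[of _ k]) (simp_all add: b'_def)
    ultimately have "box_covers c A \<phi>' I" by (intro less.hyps[of b' \<phi>'])
    then show ?thesis
      unfolding \<phi>'_def using ik(1-3) I
      by - (rule box_covers_shear[of I i k "real_of_int \<epsilon>"], simp_all)
  qed
qed

text \<open>Induction on the number of coordinates. A short dual vector provides one side of the box
  and reduces the problem to one coordinate fewer, where the minimum is still at least
  \<open>L\<close> because the remaining vectors generate a sublattice. Each side has norm at most
  \<open>4 * card I / L\<close> for the current \<open>I\<close>, which \<open>n\<close> bounds
  uniformly.\<close>

lemma box_covers_of_min_ge:
  fixes \<phi> :: "'i \<Rightarrow> 'a \<Rightarrow> real"
  assumes A: "finite A" and L: "L > 0"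
    and "finite I" "card I \<le> n" "min_ge L A \<phi> I"
  shows "box_covers (4 * real n / L) A \<phi> I"
  using assms(3-5)
proof (induction "card I" arbitrary: I \<phi>)
  case 0
  then show ?case by (auto simp: box_covers_def int_pts_def intro!: exI[of _ "\<lambda>_. 0"])
next
  case (Suc d)
  then have ne: "I \<noteq> {}" by auto
  have min: "L\<^sup>2 \<le> sqnorm A (comb I \<phi> u)" if "u \<in> int_pts I" "\<exists>i\<in>I. u i \<noteq> 0" for u
    using Suc.prems(3) that unfolding min_ge_def by blast
  show ?case
  proof (rule dual_short_vector[OF A Suc.prems(1) ne L min])
    fix f assume f: "sqnorm A f \<le> (4 * real (card I) / L)\<^sup>2"
      "\<And>i. i \<in> I \<Longrightarrow> (\<Sum>a\<in>A. f a * \<phi> i a) \<in> \<int>" "\<exists>i\<in>I. (\<Sum>a\<in>A. f a * \<phi> i a) \<noteq> 0"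
    have "(4 * real (card I) / L)\<^sup>2 \<le> (4 * real n / L)\<^sup>2"
      using Suc.prems(2) L by (intro power_mono divide_right_mono) auto
    with f(1) have f1: "sqnorm A f \<le> (4 * real n / L)\<^sup>2" by linarith
    have b: "(\<Sum>a\<in>A. f a * \<phi> i a) = of_int \<lfloor>\<Sum>a\<in>A. f a * \<phi> i a\<rfloor>" if "i \<in> I" for i
      using f(2)[OF that] by (metis Ints_cases floor_of_int)
    show "box_covers (4 * real n / L) A \<phi> I"
    proof (rule box_covers_step[OF Suc.prems(1) _ Suc.prems(3) f1 b])
      fix p and \<phi> :: "'i \<Rightarrow> 'a \<Rightarrow> real"
      assume p: "p \<in> I" and "min_ge L A \<phi> (I - {p})"
      then show "box_covers (4 * real n / L) A \<phi> (I - {p})"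
        using Suc.hyps(2) Suc.prems(1,2) by (intro Suc.hyps(1)) auto
    next
      obtain i where "i \<in> I" "(\<Sum>a\<in>A. f a * \<phi> i a) \<noteq> 0" using f(3) by blast
      then show "\<exists>i\<in>I. \<lfloor>\<Sum>a\<in>A. f a * \<phi> i a\<rfloor> \<noteq> 0" using b[of i] by (metis of_int_0)
    qed
  qed
qed

section \<open>Separation and slices\<close>

lemma lookup_scaleR: "Poly_Mapping.lookup (r *\<^sub>R x) i = r *\<^sub>R Poly_Mapping.lookup x i"
  by (simp add: scaleR_poly_mapping_def)

lemma abs_lookup_le_norm: "\<bar>Poly_Mapping.lookup x i\<bar> \<le> norm (x :: 'i \<Rightarrow>\<^sub>0 real)"
proof (cases "i \<in> Poly_Mapping.keys x")
  case True
  then have "\<bar>Poly_Mapping.lookup x i\<bar> \<le> (\<Sum>j\<in>Poly_Mapping.keys x. \<bar>Poly_Mapping.lookup x j\<bar>)"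
    by (intro member_le_sum) auto
  then show ?thesis by (simp add: norm_poly_mapping_def dist_poly_mapping_def)
qed (simp add: in_keys_iff)

lemma bounded_linear_lookup: "bounded_linear (\<lambda>x :: 'i \<Rightarrow>\<^sub>0 real. Poly_Mapping.lookup x i)"
  by (rule bounded_linear_intro[of _ 1]) (auto simp: lookup_add lookup_scaleR abs_lookup_le_norm)

definition vec_of :: "nat \<Rightarrow> (nat \<Rightarrow> real) \<Rightarrow> (nat \<Rightarrow>\<^sub>0 real)"
  where "vec_of n v = Abs_poly_mapping (\<lambda>i. if i < n then v i else 0)"

lemma lookup_vec_of: "Poly_Mapping.lookup (vec_of n v) i = (if i < n then v i else 0)"
  unfolding vec_of_def
  by (subst lookup_Abs_poly_mapping) (auto intro: finite_subset[of _ "{..<n}"] split: if_splits)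

lemma vec_of_in_Rn: "vec_of n v \<in> Rn n"
  by (auto simp: Rn_def in_keys_iff lookup_vec_of split: if_splits)

lemma lookup_Rn: "x \<in> Rn n \<Longrightarrow> \<not> i < n \<Longrightarrow> Poly_Mapping.lookup x i = 0"
  by (auto simp: Rn_def in_keys_iff subset_iff)

lemma Rn_diff: "x \<in> Rn n \<Longrightarrow> y \<in> Rn n \<Longrightarrow> x - y \<in> Rn n"
  using keys_diff[of x y] by (auto simp: Rn_def)

lemma Rn_eqI:
  assumes "x \<in> Rn n" "y \<in> Rn n" "\<And>i. i < n \<Longrightarrow> Poly_Mapping.lookup x i = Poly_Mapping.lookup y i"
  shows "x = y"
proof (rule poly_mapping_eqI)
  fix i
  show "Poly_Mapping.lookup x i = Poly_Mapping.lookup y i"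
    using assms lookup_Rn by (cases "i < n") auto
qed

definition pairing :: "nat \<Rightarrow> (nat \<Rightarrow> real) \<Rightarrow> (nat \<Rightarrow>\<^sub>0 real) \<Rightarrow> real"
  where "pairing n u x = (\<Sum>i<n. u i * Poly_Mapping.lookup x i)"

lemma pairing_diff: "pairing n u (x - y) = pairing n u x - pairing n u y"
  by (simp add: pairing_def lookup_minus right_diff_distrib sum_subtractf)

lemma pairing_uminus: "pairing n u (- x) = - pairing n u x"
  by (simp add: pairing_def sum_negf)

lemma le_0_if_le_small_multiples:
  fixes a b :: real
  assumes "\<And>t. 0 < t \<Longrightarrow> t \<le> 1 \<Longrightarrow> a \<le> t * b"
  shows "a \<le> 0"
proof (rule ccontr)
  assume a: "\<not> a \<le> 0"
  have b: "a \<le> b" using assms[of 1] by simp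
  have "a \<le> (a / (2 * b)) * b" using a b by (intro assms) (auto simp: field_simps)
  then show False using a b by simp
qed

text \<open>The separating functional is \<open>x\<close> minus its nearest point \<open>y0\<close>
  in \<open>C\<close>. Moving slightly from \<open>y0\<close> towards any \<open>y\<close> in
  \<open>C\<close> cannot bring it closer to \<open>x\<close>, so \<open>y - y0\<close> pairs with
  \<open>u\<close> to at most 0.\<close>

lemma convex_separation:
  assumes C: "compact C" "convex C" "C \<subseteq> Rn n" and x: "x \<in> Rn n" "x \<notin> C"
  obtains u where "\<And>y. y \<in> C \<Longrightarrow> pairing n u y < pairing n u x"
proof (cases "C = {}")
  case True
  then show ?thesis using that by simp
next
  case False
  \<comment> \<open>The squared Euclidean distance has to be written out, because the norm of the
    type is the 1-norm.\<close>
  define f where "f y = (\<Sum>i<n. (Poly_Mapping.lookup y i - Poly_Mapping.lookup x i)\<^sup>2)"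
    for y :: "nat \<Rightarrow>\<^sub>0 real"
  have "continuous_on C f"
    unfolding f_def
    by (intro continuous_intros linear_continuous_on bounded_linear_lookup)
  then obtain y0 where y0: "y0 \<in> C" "\<And>y. y \<in> C \<Longrightarrow> f y0 \<le> f y"
    using continuous_attains_inf[OF C(1) False] by blast
  define u where "u i = Poly_Mapping.lookup x i - Poly_Mapping.lookup y0 i" for i
  show ?thesis
  proof (rule that[of u])
    fix y assume y: "y \<in> C"
    define d where "d i = Poly_Mapping.lookup y i - Poly_Mapping.lookup y0 i" for i
    have "2 * (\<Sum>i<n. u i * d i) \<le> t * (\<Sum>i<n. (d i)\<^sup>2)" if t: "0 < t" "t \<le> 1" for t
    proof -
      have "(1 - t) *\<^sub>R y0 + t *\<^sub>R y \<in> C"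
        using C(2) y y0(1) t by (intro convexD) auto
      then have "f y0 \<le> f ((1 - t) *\<^sub>R y0 + t *\<^sub>R y)" by (rule y0(2))
      also have "\<dots> = (\<Sum>i<n. (t * d i - u i)\<^sup>2)"
        unfolding f_def lookup_add lookup_scaleR d_def u_def
        by (intro sum.cong arg_cong[where f = "\<lambda>r. r\<^sup>2"]) (simp_all add: algebra_simps)
      also have "\<dots> = (\<Sum>i<n. (u i)\<^sup>2 - t * (2 * (u i * d i)) + t * (t * (d i)\<^sup>2))"
        by (intro sum.cong) (auto simp: power2_eq_square algebra_simps)
      also have "\<dots> = (\<Sum>i<n. (u i)\<^sup>2) - t * (2 * (\<Sum>i<n. u i * d i)) + t * (t * (\<Sum>i<n. (d i)\<^sup>2))"
        by (simp add: sum.distrib sum_subtractf sum_distrib_left)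
      also have "(\<Sum>i<n. (u i)\<^sup>2) = f y0"
        unfolding f_def u_def by (simp add: power2_commute)
      finally have "t * (2 * (\<Sum>i<n. u i * d i)) \<le> t * (t * (\<Sum>i<n. (d i)\<^sup>2))" by simp
      then show ?thesis using t by simp
    qed
    then have "2 * (\<Sum>i<n. u i * d i) \<le> 0" by (rule le_0_if_le_small_multiples)
    then have le: "(\<Sum>i<n. u i * d i) \<le> 0" by simp
    have "x \<noteq> y0" using x(2) y0(1) by auto
    then obtain i where i: "i < n" "Poly_Mapping.lookup x i \<noteq> Poly_Mapping.lookup y0 i"
      using Rn_eqI[OF x(1), of y0] y0(1) C(3) by blast
    then have "0 < (\<Sum>i<n. (u i)\<^sup>2)"
      by (intro sum_pos2[of _ i]) (auto simp: u_def)
    moreover have "pairing n u x - pairing n u y = (\<Sum>i<n. (u i)\<^sup>2) - (\<Sum>i<n. u i * d i)"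
      unfolding pairing_def sum_subtractf[symmetric]
      by (intro sum.cong) (auto simp: u_def d_def power2_eq_square algebra_simps)
    ultimately show "pairing n u y < pairing n u x" using le by linarith
  qed
qed

lemma Zn_vec_of: "v \<in> int_pts {..<n} \<Longrightarrow> vec_of n v \<in> Zn n"
  by (auto simp: Zn_def vec_of_in_Rn lookup_vec_of int_pts_def)

section \<open>Counting lattice points by slices\<close>

lemma card_fiber_le_max_slice_count:
  assumes K: "convex_body n K" and u: "u \<in> int_pts {..<n}" "\<exists>i\<in>{..<n}. u i \<noteq> 0"
    and x0: "x0 \<in> K \<inter> Zn n"
  shows "card {x \<in> K \<inter> Zn n. pairing n u x = pairing n u x0} \<le> max_slice_count n K"
proof -
  have dot: "dot n x (vec_of n u) = pairing n u x" for x
    by (simp add: dot_def pairing_def lookup_vec_of mult.commute)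
  have "vec_of n u \<noteq> 0"
  proof
    assume "vec_of n u = 0"
    moreover obtain i where "i < n" "u i \<noteq> 0" using u(2) by auto
    ultimately show False using lookup_vec_of[of n u i] by simp
  qed
  then have "lattice_count n (K \<inter> (\<lambda>x. x0 + x) ` orth n (vec_of n u)) \<in> slice_counts n K"
    unfolding slice_counts_def using x0 Zn_vec_of[OF u(1)] by blast
  then have "lattice_count n (K \<inter> (\<lambda>x. x0 + x) ` orth n (vec_of n u)) \<le> max_slice_count n K"
    unfolding max_slice_count_def by (intro Max_ge finite_slice_counts[OF K])
  moreover have "{x \<in> K \<inter> Zn n. pairing n u x = pairing n u x0} \<subseteq>
      (K \<inter> (\<lambda>x. x0 + x) ` orth n (vec_of n u)) \<inter> Zn n"
  proof
    fix x assume x: "x \<in> {x \<in> K \<inter> Zn n. pairing n u x = pairing n u x0}"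
    then have "x - x0 \<in> orth n (vec_of n u)"
      using x0 by (auto simp: orth_def dot pairing_diff Zn_def Rn_diff)
    then have "x0 + (x - x0) \<in> (\<lambda>x. x0 + x) ` orth n (vec_of n u)" by (rule imageI)
    then show "x \<in> (K \<inter> (\<lambda>x. x0 + x) ` orth n (vec_of n u)) \<inter> Zn n" using x by simp
  qed
  then have "card {x \<in> K \<inter> Zn n. pairing n u x = pairing n u x0} \<le>
      lattice_count n (K \<inter> (\<lambda>x. x0 + x) ` orth n (vec_of n u))"
    unfolding lattice_count_def
    by (intro card_mono finite_subset[OF _ finite_lattice_points[OF K]]) auto
  ultimately show ?thesis by linarith
qed

lemma pairing_Ints:
  assumes "u \<in> int_pts {..<n}" "x \<in> Zn n"
  shows "pairing n u x \<in> \<int>"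
  using assms unfolding pairing_def by (intro Ints_sum) (auto simp: int_pts_def Zn_def)

text \<open>By Chebyshev's inequality three quarters of the lattice points lie in at most \<open>4 S + 2\<close> slices.\<close>

lemma card_le_slices:
  assumes K: "convex_body n K" and u: "u \<in> int_pts {..<n}" "\<exists>i\<in>{..<n}. u i \<noteq> 0"
    and S: "S \<ge> 1"
    and var: "sqnorm (K \<inter> Zn n) (\<lambda>x. pairing n u x - \<mu>) \<le> real (card (K \<inter> Zn n)) * S\<^sup>2"
  shows "real (card (K \<inter> Zn n)) \<le> 8 * S * real (max_slice_count n K)"
proof -
  define A where "A = K \<inter> Zn n"
  have fin: "finite A" unfolding A_def by (rule finite_lattice_points[OF K])
  \<comment> \<open>Each point outside \<open>G\<close> contributes more than
    \<open>(2 * S)\<^sup>2\<close> to the variance sum, so at most a quarter of the points are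
    outside.\<close>
  define G where "G = {x \<in> A. \<bar>pairing n u x - \<mu>\<bar> \<le> 2 * S}"
  have finG: "finite G" using fin by (simp add: G_def)
  have "real (card (A - G)) * (2 * S)\<^sup>2 = (\<Sum>x\<in>A - G. (2 * S)\<^sup>2)" by simp
  also have "\<dots> \<le> (\<Sum>x\<in>A - G. (pairing n u x - \<mu>)\<^sup>2)"
  proof (rule sum_mono)
    fix x assume "x \<in> A - G"
    then show "(2 * S)\<^sup>2 \<le> (pairing n u x - \<mu>)\<^sup>2"
      using S by (intro abs_le_square_iff[THEN iffD1]) (auto simp: G_def)
  qed
  also have "\<dots> \<le> sqnorm A (\<lambda>x. pairing n u x - \<mu>)"
    unfolding sqnorm_def using fin by (intro sum_mono2) auto
  also have "\<dots> \<le> real (card A) * S\<^sup>2" using var by (simp add: A_def)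
  finally have "(4 * real (card (A - G))) * S\<^sup>2 \<le> real (card A) * S\<^sup>2"
    by (simp add: power_mult_distrib)
  then have "4 * real (card (A - G)) \<le> real (card A)"
    using S by (simp add: mult_le_cancel_right)
  moreover have "real (card (A - G)) = real (card A) - real (card G)"
    using fin finG by (subst card_Diff_subset) (auto simp: G_def of_nat_diff card_mono)
  ultimately have GA: "3 * real (card A) \<le> 4 * real (card G)" by linarith
  \<comment> \<open>The pairing is integral on lattice points, so equal floors mean equal values,
    that is, the same slice.\<close>
  have fibers: "card G \<le> max_slice_count n K * card ((\<lambda>x. \<lfloor>pairing n u x\<rfloor>) ` G)"
  proof (rule card_le_fibers)
    fix c assume "c \<in> (\<lambda>x. \<lfloor>pairing n u x\<rfloor>) ` G"
    then obtain x0 where x0: "x0 \<in> G" "c = \<lfloor>pairing n u x0\<rfloor>" by blast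
    have int: "of_int \<lfloor>pairing n u x\<rfloor> = pairing n u x" if "x \<in> A" for x
      using pairing_Ints[OF u(1), of x] that by (auto simp: A_def elim: Ints_cases)
    have "{x \<in> G. \<lfloor>pairing n u x\<rfloor> = c} \<subseteq> {x \<in> K \<inter> Zn n. pairing n u x = pairing n u x0}"
    proof
      fix x assume "x \<in> {x \<in> G. \<lfloor>pairing n u x\<rfloor> = c}"
      then have x: "x \<in> A" and eq: "\<lfloor>pairing n u x\<rfloor> = \<lfloor>pairing n u x0\<rfloor>" and "x0 \<in> A"
        using x0 by (auto simp: G_def)
      then have "pairing n u x = pairing n u x0" by (metis int)
      then show "x \<in> {x \<in> K \<inter> Zn n. pairing n u x = pairing n u x0}"
        using x by (simp add: A_def)
    qed
    then have "card {x \<in> G. \<lfloor>pairing n u x\<rfloor> = c} \<le>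
        card {x \<in> K \<inter> Zn n. pairing n u x = pairing n u x0}"
      by (rule card_mono[rotated]) (rule finite_subset[OF _ fin], auto simp: A_def)
    also have "\<dots> \<le> max_slice_count n K"
      using x0 by (intro card_fiber_le_max_slice_count[OF K u]) (auto simp: G_def A_def)
    finally show "card {x \<in> G. \<lfloor>pairing n u x\<rfloor> = c} \<le> max_slice_count n K" .
  qed (use finG in auto)
  have "card ((\<lambda>x. \<lfloor>pairing n u x\<rfloor>) ` G) \<le> card {\<lfloor>\<mu> - 2 * S\<rfloor>..\<lfloor>\<mu> + 2 * S\<rfloor>}"
  proof (rule card_mono)
    show "(\<lambda>x. \<lfloor>pairing n u x\<rfloor>) ` G \<subseteq> {\<lfloor>\<mu> - 2 * S\<rfloor>..\<lfloor>\<mu> + 2 * S\<rfloor>}"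
    proof (rule image_subsetI)
      fix x assume "x \<in> G"
      then have "\<mu> - 2 * S \<le> pairing n u x" "pairing n u x \<le> \<mu> + 2 * S" by (auto simp: G_def)
      then show "\<lfloor>pairing n u x\<rfloor> \<in> {\<lfloor>\<mu> - 2 * S\<rfloor>..\<lfloor>\<mu> + 2 * S\<rfloor>}"
        by (simp add: floor_mono)
    qed
  qed simp
  \<comment> \<open>There are at most \<open>4 * S + 2\<close> integers in the range, and
    \<open>S \<ge> 1\<close> makes this at most \<open>6 * S\<close>. The factor 4/3 lost in passing
    to \<open>G\<close> turns 6 into 8.\<close>
  moreover have "real (card {\<lfloor>\<mu> - 2 * S\<rfloor>..\<lfloor>\<mu> + 2 * S\<rfloor>}) \<le> 6 * S"
    using S unfolding card_atLeastAtMost_int by linarith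
  ultimately have "real (card ((\<lambda>x. \<lfloor>pairing n u x\<rfloor>) ` G)) \<le> 6 * S" by linarith
  then have "real (max_slice_count n K) * real (card ((\<lambda>x. \<lfloor>pairing n u x\<rfloor>) ` G)) \<le>
      real (max_slice_count n K) * (6 * S)"
    by (rule mult_left_mono) simp
  moreover have "real (card G) \<le>
      real (max_slice_count n K) * real (card ((\<lambda>x. \<lfloor>pairing n u x\<rfloor>) ` G))"
    using fibers by (metis of_nat_le_iff of_nat_mult)
  ultimately show ?thesis using GA by (simp add: A_def mult_ac)
qed

section \<open>Short integer functionals\<close>

lemma sqnorm_nonneg: "0 \<le> sqnorm A f"
  by (simp add: sqnorm_def sum_nonneg)

lemma sqnorm_less:
  assumes "finite A" "A \<noteq> {}" "\<And>x. x \<in> A \<Longrightarrow> \<bar>g x\<bar> < B"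
  shows "sqnorm A g < real (card A) * B\<^sup>2"
proof -
  have "sqnorm A g < (\<Sum>x\<in>A. B\<^sup>2)"
    unfolding sqnorm_def
  proof (rule sum_strict_mono[OF assms(1,2)])
    fix x assume "x \<in> A"
    then have "\<bar>g x\<bar>\<^sup>2 < B\<^sup>2" using assms(3) by (intro power_strict_mono) auto
    then show "(g x)\<^sup>2 < B\<^sup>2" by simp
  qed
  then show ?thesis by simp
qed

lemma sqnorm_divide: "sqnorm A (\<lambda>x. g x / r) = sqnorm A g / r\<^sup>2"
  by (simp add: sqnorm_def power_divide sum_divide_distrib)

lemma inner_le_of_sqnorm_le:
  assumes "sqnorm A f \<le> c\<^sup>2" "0 \<le> c"
  shows "(\<Sum>a\<in>A. f a * g a) \<le> c * sqrt (sqnorm A g)"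
proof -
  have "(\<Sum>a\<in>A. f a * g a)\<^sup>2 \<le> sqnorm A f * sqnorm A g"
    unfolding sqnorm_def by (rule Cauchy_Schwarz_ineq_sum)
  also have "\<dots> \<le> c\<^sup>2 * sqnorm A g"
    using assms(1) sqnorm_nonneg by (intro mult_right_mono)
  also have "\<dots> = (c * sqrt (sqnorm A g))\<^sup>2"
    using sqnorm_nonneg[of A g] by (simp add: power_mult_distrib)
  finally show ?thesis
    by (rule power2_le_imp_le) (simp add: assms(2) sqnorm_nonneg)
qed

text \<open>The mean square of \<open>pairing n u\<close> over the lattice points of
  \<open>K\<close> is the square of the support function of an ellipsoid contained in
  \<open>K\<close>. This ellipsoid has at most \<open>N\<close> lattice points, which bounds the
  product of the \<open>l j\<close> from above, and Minkowski's argument then produces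
  \<open>u\<close>.\<close>

lemma exists_short_symmetric:
  assumes n: "n \<ge> 1" and K: "convex_body n K" "origin_symmetric K" and N: "K \<inter> Zn n \<noteq> {}"
  defines "N \<equiv> real (card (K \<inter> Zn n))"
  obtains u where "u \<in> int_pts {..<n}" "\<exists>i\<in>{..<n}. u i \<noteq> 0"
    "sqnorm (K \<inter> Zn n) (pairing n u) \<le> N * (2 * real n * N powr (1 / n))\<^sup>2"
proof -
  define A where "A = K \<inter> Zn n"
  have fin: "finite A" unfolding A_def by (rule finite_lattice_points[OF K(1)])
  have A0: "A \<noteq> {}" using N by (simp add: A_def)
  have N_card: "N = real (card A)" by (simp add: N_def A_def)
  have N0: "N > 0" using fin A0 by (simp add: N_card card_gt_0_iff)
  define \<phi> where "\<phi> i x = Poly_Mapping.lookup x i / sqrt N" for i and x :: "nat \<Rightarrow>\<^sub>0 real"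
  have comb: "comb {..<n} \<phi> u x = pairing n u x / sqrt N" for u x
    by (simp add: comb_def \<phi>_def pairing_def sum_divide_distrib)
  have sq_comb: "sqnorm A (comb {..<n} \<phi> u) = sqnorm A (pairing n u) / N" for u
    unfolding comb[abs_def] sqnorm_divide using N0 by simp
  have finn: "finite {..<n}" by simp
  show thesis
  proof (rule gram_schmidt_normalized[OF fin finn, of \<phi>])
    fix G H l \<psi> assume G: "triangular {..<n} G" and H: "triangular {..<n} H" and l: "\<And>j. 0 \<le> l j"
      and sq: "\<And>u. sqnorm A (comb {..<n} \<phi> u) = (\<Sum>j<n. (l j * G u j)\<^sup>2)"
      and dual: "\<And>x u. (\<Sum>i<n. x i * u i) = (\<Sum>j<n. G u j * H x j)"
    \<comment> \<open>In the coordinates \<open>H x j / l j\<close> the ellipsoid is the unit ball,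
      which contains the cube of half-side \<open>1 / sqrt n\<close>. Were the product larger,
      \<open>triangular_blichfeldt\<close> would give more than \<open>N\<close> integer points
      whose differences lie in that cube, hence in \<open>K\<close>.\<close>
    have prod_le: "(\<Prod>j<n. l j) \<le> N * sqrt n ^ n"
    proof (rule ccontr)
      assume "\<not> ?thesis"
      then have gt: "N * sqrt n ^ n < (\<Prod>j<n. l j)" by simp
      have "0 \<le> N * sqrt n ^ n" using N0 by simp
      with gt have pos: "0 < (\<Prod>j<n. l j)" by linarith
      then have lne: "l j \<noteq> 0" if "j < n" for j
        using that by (metis finn less_irrefl lessThan_iff prod_zero)
      have "N * (\<Prod>j<n. 1 / l j) = N / (\<Prod>j<n. l j)" by (simp add: prod_dividef)
      also have "\<dots> < (1 / sqrt n) ^ n"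
        using gt pos n by (simp add: power_divide divide_simps mult.commute)
      finally have less: "real (card A) * (\<Prod>j<n. 1 / l j) < (1 / sqrt n) ^ card {..<n}"
        by (simp add: N_card)
      have T: "0 < 1 / sqrt n" using n by simp
      have l': "0 \<le> 1 / l j" for j using l by simp
      show False
      proof (rule triangular_blichfeldt[OF finn H l' T less])
        fix X assume X: "X \<subseteq> int_pts {..<n}" "finite X" "card A < card X"
          and close: "\<And>x y j. x \<in> X \<Longrightarrow> y \<in> X \<Longrightarrow> j \<in> {..<n} \<Longrightarrow> 1 / l j * \<bar>H x j - H y j\<bar> < 1 / sqrt n"
        then obtain y where y: "y \<in> X" by (metis card.empty all_not_in_conv not_less_zero)
        have in_K: "vec_of n (\<lambda>i. x i - y i) \<in> K" if x: "x \<in> X" for x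
        proof (rule ccontr)
          let ?v = "\<lambda>i. x i - y i"
          assume notin: "vec_of n ?v \<notin> K"
          have cK: "compact K" "convex K" "K \<subseteq> Rn n" using K(1) by (auto simp: convex_body_def)
          show False
          \<comment> \<open>If \<open>u\<close> separates the difference vector from
            \<open>K\<close>, then by symmetry \<open>pairing n u\<close> is below \<open>?B\<close>
            in absolute value on all of \<open>A\<close>, so its mean square is below
            \<open>?B\<^sup>2\<close>. Cauchy-Schwarz in the dual coordinates gives the opposite
            inequality.\<close>
          proof (rule convex_separation[OF cK vec_of_in_Rn notin])
            fix u assume sep: "\<And>z. z \<in> K \<Longrightarrow> pairing n u z < pairing n u (vec_of n ?v)"
            let ?B = "pairing n u (vec_of n ?v)"
            have "?B = (\<Sum>j<n. G u j * H ?v j)"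
              using dual[of ?v u] by (simp add: pairing_def lookup_vec_of mult.commute)
            also have "\<dots> = (\<Sum>j<n. (H ?v j / l j) * (l j * G u j))"
              using lne by (intro sum.cong) (simp_all add: mult.commute)
            also have "\<dots> \<le> 1 * sqrt (sqnorm {..<n} (\<lambda>j. l j * G u j))"
            proof (rule inner_le_of_sqnorm_le)
              have "sqnorm {..<n} (\<lambda>j. H ?v j / l j) \<le> real (card {..<n}) * (1 / sqrt n)\<^sup>2"
                unfolding sqnorm_def
              proof (rule sum_squares_le)
                fix j assume j: "j \<in> {..<n}"
                show "\<bar>H ?v j / l j\<bar> < 1 / sqrt n"
                  using close[OF x y j] l[of j] by (simp add: triangular_diff[OF H j] abs_divide)
              qed
              then show "sqnorm {..<n} (\<lambda>j. H ?v j / l j) \<le> 1\<^sup>2"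
                using n by (simp add: power_divide)
            qed simp
            also have "sqnorm {..<n} (\<lambda>j. l j * G u j) = sqnorm A (pairing n u) / N"
              unfolding sq_comb[symmetric] sq by (simp add: sqnorm_def)
            finally have B: "?B \<le> sqrt (sqnorm A (pairing n u) / N)" by simp
            have abs: "\<bar>pairing n u z\<bar> < ?B" if "z \<in> A" for z
            proof -
              have "z \<in> K" using that by (simp add: A_def)
              then have "- z \<in> K" using K(2) unfolding origin_symmetric_def by (metis imageI)
              then show ?thesis
                using sep[OF \<open>z \<in> K\<close>] sep[of "- z"] by (auto simp: pairing_uminus)
            qed
            then have "sqnorm A (pairing n u) < N * ?B\<^sup>2"
              unfolding N_card by (intro sqnorm_less[OF fin A0])
            moreover have "0 \<le> ?B" using abs A0 by (metis abs_ge_zero ex_in_conv less_imp_le order_trans)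
            then have "?B\<^sup>2 \<le> (sqrt (sqnorm A (pairing n u) / N))\<^sup>2" using B by (intro power_mono)
            then have "?B\<^sup>2 \<le> sqnorm A (pairing n u) / N"
              using N0 sqnorm_nonneg[of A] by simp
            then have "N * ?B\<^sup>2 \<le> sqnorm A (pairing n u)" using N0 by (simp add: field_simps)
            ultimately show False by simp
          qed
        qed
        have "(\<lambda>x. vec_of n (\<lambda>i. x i - y i)) ` X \<subseteq> A"
          unfolding A_def using in_K X(1) y by (blast intro: Zn_vec_of int_pts_diff)
        moreover have "inj_on (\<lambda>x. vec_of n (\<lambda>i. x i - y i)) X"
        proof (rule inj_onI)
          fix x x' assume x: "x \<in> X" "x' \<in> X"
            and eq: "vec_of n (\<lambda>i. x i - y i) = vec_of n (\<lambda>i. x' i - y i)"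
          show "x = x'"
          proof
            fix i
            have "x \<in> int_pts {..<n}" "x' \<in> int_pts {..<n}" using x X(1) by auto
            then show "x i = x' i"
              using arg_cong[OF eq, of "\<lambda>v. Poly_Mapping.lookup v i"]
              by (cases "i < n") (auto simp: lookup_vec_of int_pts_def)
          qed
        qed
        ultimately have "card X \<le> card A" using fin by (metis card_inj_on_le)
        then show False using X(3) by simp
      qed
    qed
    \<comment> \<open>\<open>T ^ n\<close> is \<open>2 ^ n\<close> times the bound on the product,
      hence strictly larger than the product. The \<open>n\<close> coordinates below
      \<open>T\<close> add up to at most \<open>n * T\<^sup>2\<close>, which is the square of
      \<open>2 * n * N powr (1 / n)\<close>.\<close>
    define T where "T = 2 * sqrt n * N powr (1 / n)"
    have T0: "T > 0" using n N0 by (simp add: T_def)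
    have "(N powr (1 / n)) ^ n = N" using n N0 by (simp add: powr_powr flip: powr_realpow)
    then have Tn: "T ^ n = 2 ^ n * (N * sqrt n ^ n)" by (simp add: T_def power_mult_distrib)
    have "0 < N * sqrt n ^ n" using N0 n by simp
    moreover have "(1::real) < 2 ^ n" using n by simp
    ultimately have "1 * (N * sqrt n ^ n) < T ^ n" unfolding Tn by (rule mult_strict_right_mono[rotated])
    then have less: "(\<Prod>j<n. l j) < T ^ card {..<n}" using prod_le by simp
    show thesis
    proof (rule triangular_minkowski[OF finn G l T0 less])
      fix u assume u: "u \<in> int_pts {..<n}" "\<exists>i\<in>{..<n}. u i \<noteq> 0"
        "\<And>j. j \<in> {..<n} \<Longrightarrow> l j * \<bar>G u j\<bar> < T"
      have "sqnorm A (comb {..<n} \<phi> u) \<le> real (card {..<n}) * T\<^sup>2"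
        unfolding sq by (rule sum_squares_le) (use u(3) l in \<open>simp add: abs_mult\<close>)
      also have "\<dots> = (2 * real n * N powr (1 / n))\<^sup>2"
        using n by (simp add: T_def power_mult_distrib) (simp add: power2_eq_square)
      finally have "sqnorm A (pairing n u) \<le> N * (2 * real n * N powr (1 / n))\<^sup>2"
        unfolding sq_comb using N0 by (simp add: divide_le_eq mult.commute)
      then show thesis using u(1,2) that by (simp add: A_def)
    qed
  qed
qed

section \<open>Short functionals for general convex bodies\<close>

text \<open>The deviation from the mean is the average of the differences \<open>p x - p y\<close>.
  This turns a bound on the difference body into a bound on the standard deviation.\<close>

lemma abs_diff_mean_less:
  fixes p :: "'a \<Rightarrow> real"
  assumes "finite A" "A \<noteq> {}" "x \<in> A" and B: "\<And>x y. x \<in> A \<Longrightarrow> y \<in> A \<Longrightarrow> p x - p y < B"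
  shows "\<bar>p x - (\<Sum>y\<in>A. p y) / real (card A)\<bar> < B"
proof -
  have N: "0 < real (card A)" using assms(1,2) by (simp add: card_gt_0_iff)
  have "(\<Sum>y\<in>A. p x - p y) = real (card A) * (p x - (\<Sum>y\<in>A. p y) / real (card A))"
    using N by (simp add: sum_subtractf right_diff_distrib)
  then have "real (card A) * \<bar>p x - (\<Sum>y\<in>A. p y) / real (card A)\<bar> = \<bar>\<Sum>y\<in>A. p x - p y\<bar>"
    by (simp add: abs_mult)
  also have "\<dots> \<le> (\<Sum>y\<in>A. \<bar>p x - p y\<bar>)" by (rule sum_abs)
  also have "\<dots> < (\<Sum>y\<in>A. B)"
  proof (rule sum_strict_mono[OF assms(1,2)])
    fix y assume "y \<in> A"
    then show "\<bar>p x - p y\<bar> < B" using B[of x y] B[of y x] assms(3) by auto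
  qed
  finally show ?thesis using N by simp
qed

text \<open>The vector represented by \<open>f\<close>, divided by \<open>c\<close>, lies in the
  difference body of \<open>K\<close>. A functional \<open>u\<close> separating it would exceed all
  differences over \<open>A\<close>, and so the standard deviation, by
  \<open>abs_diff_mean_less\<close>; Cauchy-Schwarz bounds its value by that same deviation.\<close>

lemma segment_of_functional:
  assumes K: "compact K" "convex K" "K \<subseteq> Rn n" and A: "finite A" "A \<noteq> {}" "A \<subseteq> K"
    and N: "N = real (card A)" and c: "c > 0" and f: "sqnorm A f \<le> c\<^sup>2"
    and \<phi>: "\<And>u x. comb {..<n} \<phi> u x =
      (pairing n u x - (\<Sum>y\<in>A. pairing n u y) / real (card A)) / sqrt N"
  obtains p q where "p \<in> K" "q \<in> K"
    "\<And>i. i < n \<Longrightarrow> (\<Sum>a\<in>A. f a * \<phi> i a) = c * (Poly_Mapping.lookup p i - Poly_Mapping.lookup q i)"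
proof -
  have N0: "N > 0" using A(1,2) by (simp add: N card_gt_0_iff)
  define w where "w i = (\<Sum>a\<in>A. f a * \<phi> i a) / c" for i
  have cw: "c * w i = (\<Sum>a\<in>A. f a * \<phi> i a)" for i
    using c by (simp add: w_def)
  define D where "D = (\<Union>x\<in>K. \<Union>y\<in>K. {x - y})"
  have D: "compact D" "convex D" "D \<subseteq> Rn n"
    unfolding D_def using K by (auto intro!: compact_differences' convex_differences Rn_diff)
  have "vec_of n w \<in> D"
  proof (rule ccontr)
    assume notin: "vec_of n w \<notin> D"
    show False
    proof (rule convex_separation[OF D vec_of_in_Rn notin])
      fix u assume sep: "\<And>y. y \<in> D \<Longrightarrow> pairing n u y < pairing n u (vec_of n w)"
      let ?B = "pairing n u (vec_of n w)"
      let ?g = "\<lambda>x. pairing n u x - (\<Sum>y\<in>A. pairing n u y) / real (card A)"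
      have "c * ?B = (\<Sum>i<n. u i * (\<Sum>a\<in>A. f a * \<phi> i a))"
        unfolding cw[symmetric] by (simp add: pairing_def lookup_vec_of sum_distrib_left mult_ac)
      also have "\<dots> = (\<Sum>a\<in>A. f a * comb {..<n} \<phi> u a)"
        unfolding comb_def sum_distrib_left by (subst sum.swap) (simp add: mult_ac)
      also have "\<dots> \<le> c * sqrt (sqnorm A (comb {..<n} \<phi> u))"
        using f c by (intro inner_le_of_sqnorm_le) auto
      finally have "?B \<le> sqrt (sqnorm A (comb {..<n} \<phi> u))" using c by simp
      also have "sqnorm A (comb {..<n} \<phi> u) = sqnorm A ?g / N"
        unfolding \<phi>[abs_def] sqnorm_divide using N0 by simp
      finally have B: "?B \<le> sqrt (sqnorm A ?g / N)" .
      have diff: "pairing n u x - pairing n u y < ?B" if "x \<in> A" "y \<in> A" for x y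
        using sep[of "x - y"] that A(3) by (auto simp: D_def pairing_diff)
      have "sqnorm A ?g < N * ?B\<^sup>2"
        unfolding N using diff A by (intro sqnorm_less abs_diff_mean_less) auto
      moreover have "0 \<le> ?B" using diff A(2) by (metis diff_self ex_in_conv less_imp_le)
      then have "?B\<^sup>2 \<le> (sqrt (sqnorm A ?g / N))\<^sup>2" using B by (intro power_mono)
      then have "?B\<^sup>2 \<le> sqnorm A ?g / N" using N0 sqnorm_nonneg[of A ?g] by simp
      then have "N * ?B\<^sup>2 \<le> sqnorm A ?g" using N0 by (simp add: field_simps)
      ultimately show False by simp
    qed
  qed
  then obtain p q where pq: "p \<in> K" "q \<in> K" "vec_of n w = p - q" by (auto simp: D_def)
  show thesis
  proof (rule that[OF pq(1,2)])
    fix i assume "i < n"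
    then have "w i = Poly_Mapping.lookup p i - Poly_Mapping.lookup q i"
      using arg_cong[OF pq(3), of "\<lambda>v. Poly_Mapping.lookup v i"]
      by (simp add: lookup_vec_of lookup_minus)
    then show "(\<Sum>a\<in>A. f a * \<phi> i a) = c * (Poly_Mapping.lookup p i - Poly_Mapping.lookup q i)"
      using c by (simp add: w_def field_simps)
  qed
qed

text \<open>
  If the box spanned by the vectors \<open>w j = c (p j - q j)\<close> covers modulo \<open>\<int>\<^sup>n\<close>, then \<open>K\<close>
  contains a translate of its \<open>k\<close>-fold dilate and hence meets every residue class modulo \<open>k\<close>.
\<close>

lemma power_le_card_lattice_points:
  assumes n: "n \<ge> 1" and K: "convex_body n K" and k: "k \<ge> 1"
    and pq: "\<And>j. j < n \<Longrightarrow> p j \<in> K" "\<And>j. j < n \<Longrightarrow> q j \<in> K"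
    and w: "\<And>i j. i < n \<Longrightarrow> j < n \<Longrightarrow>
      w j i = 1 / (real n * real k) * (Poly_Mapping.lookup (p j) i - Poly_Mapping.lookup (q j) i)"
    and cover: "\<And>y. \<exists>z\<in>int_pts {..<n}. \<exists>\<theta>. (\<forall>j\<in>{..<n}. 0 \<le> \<theta> j \<and> \<theta> j \<le> 1) \<and>
      (\<forall>i\<in>{..<n}. y i = z i + (\<Sum>j<n. \<theta> j * w j i))"
  shows "k ^ n \<le> card (K \<inter> Zn n)"
proof -
  have cK: "convex K" "K \<subseteq> Rn n" using K by (auto simp: convex_body_def)
  have "\<exists>x\<in>K \<inter> Zn n. \<forall>i<n. \<exists>m::int. Poly_Mapping.lookup x i = real_of_int (r i - int k * m)"
    for r :: "nat \<Rightarrow> int"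
  proof -
    \<comment> \<open>The corner of the box inside \<open>K\<close>: the average of the points
      \<open>q j\<close>. Covering is applied to the target residue relative to this corner, scaled
      down by \<open>k\<close>.\<close>
    define x0 where "x0 i = (\<Sum>j<n. 1 / real n * Poly_Mapping.lookup (q j) i)" for i
    obtain z \<theta> where z: "z \<in> int_pts {..<n}" and \<theta>: "\<And>j. j < n \<Longrightarrow> 0 \<le> \<theta> j \<and> \<theta> j \<le> 1"
      and y: "\<And>i. i < n \<Longrightarrow> (real_of_int (r i) - x0 i) / k = z i + (\<Sum>j<n. \<theta> j * w j i)"
      using cover[of "\<lambda>i. (real_of_int (r i) - x0 i) / k"] by auto
    \<comment> \<open>An average of points on the segments from \<open>q j\<close> to
      \<open>p j\<close>, hence in \<open>K\<close>. As each \<open>w j\<close> carries the factor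
      \<open>1 / (n * k)\<close>, it equals \<open>x0\<close> plus \<open>k\<close> times the box
      point, that is, \<open>r - k * z\<close> in coordinates.\<close>
    define x where "x = (\<Sum>j<n. (1 / real n) *\<^sub>R ((1 - \<theta> j) *\<^sub>R q j + \<theta> j *\<^sub>R p j))"
    have xK: "x \<in> K"
      unfolding x_def using n pq \<theta> by (intro convex_sum convexD cK(1)) auto
    have lookup_x: "Poly_Mapping.lookup x i = real_of_int (r i) - real k * z i" if i: "i < n" for i
    proof -
      have "Poly_Mapping.lookup x i = (\<Sum>j<n. 1 / real n * Poly_Mapping.lookup (q j) i +
          real k * (\<theta> j * w j i))"
        unfolding x_def lookup_sum
      proof (intro sum.cong refl)
        fix j assume "j \<in> {..<n}"
        then have wj: "w j i = 1 / (real n * real k) *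
            (Poly_Mapping.lookup (p j) i - Poly_Mapping.lookup (q j) i)"
          using w i by simp
        show "Poly_Mapping.lookup ((1 / real n) *\<^sub>R ((1 - \<theta> j) *\<^sub>R q j + \<theta> j *\<^sub>R p j)) i =
            1 / real n * Poly_Mapping.lookup (q j) i + real k * (\<theta> j * w j i)"
          unfolding lookup_add lookup_scaleR wj using n k by (simp add: field_simps)
      qed
      also have "\<dots> = x0 i + real k * (\<Sum>j<n. \<theta> j * w j i)"
        by (simp add: sum.distrib x0_def sum_distrib_left)
      also have "(\<Sum>j<n. \<theta> j * w j i) = (real_of_int (r i) - x0 i) / k - z i"
        using y[OF i] by simp
      finally show ?thesis using k by (simp add: right_diff_distrib diff_divide_distrib)
    qed
    have int: "\<exists>m. Poly_Mapping.lookup x i = real_of_int (r i - int k * m)" if i: "i < n" for i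
    proof -
      have "z i \<in> \<int>" using z i by (simp add: int_pts_def)
      then obtain m where "z i = of_int m" by (elim Ints_cases)
      then show ?thesis by (intro exI[of _ m]) (simp add: lookup_x[OF i])
    qed
    have "Poly_Mapping.lookup x i \<in> \<int>" for i
      using int[of i] lookup_Rn[of x n i] xK cK(2) by (cases "i < n") auto
    then have "x \<in> Zn n" using xK cK(2) by (auto simp: Zn_def)
    then show ?thesis using xK int by blast
  qed
  then obtain X where X: "\<And>r. X r \<in> K \<inter> Zn n"
    "\<And>r i. i < n \<Longrightarrow> \<exists>m::int. Poly_Mapping.lookup (X r) i = real_of_int (r i - int k * m)"
    by metis
  \<comment> \<open>One representative of each residue class modulo \<open>k\<close>; points of
    \<open>K\<close> in different classes are distinct.\<close>
  define R where "R = PiE {..<n} (\<lambda>_. {0..<int k})"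
  have "inj_on X R"
  proof (rule inj_onI)
    fix r s assume r: "r \<in> R" and s: "s \<in> R" and eq: "X r = X s"
    show "r = s"
    proof (rule PiE_ext[OF r[unfolded R_def] s[unfolded R_def]])
      fix i assume i: "i \<in> {..<n}"
      obtain m where m: "Poly_Mapping.lookup (X r) i = real_of_int (r i - int k * m)"
        using X(2) i by blast
      obtain m' where m': "Poly_Mapping.lookup (X s) i = real_of_int (s i - int k * m')"
        using X(2) i by blast
      have "real_of_int (r i - int k * m) = real_of_int (s i - int k * m')"
        using m m' eq by metis
      then have "r i - int k * m = s i - int k * m'" by (simp only: of_int_eq_iff)
      then have "r i = s i + int k * (m - m')" by (simp add: algebra_simps)
      then have "r i mod int k = s i mod int k" by simp
      then show "r i = s i" using r s i by (auto simp: R_def PiE_iff)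
    qed
  qed
  then have "card R \<le> card (K \<inter> Zn n)"
    using X(1) finite_lattice_points[OF K] by (metis card_inj_on_le image_subsetI)
  then show ?thesis by (simp add: R_def card_PiE)
qed

text \<open>If every nonzero integer functional had standard deviation at least \<open>L\<close>,
  the covering box would force \<open>k ^ n\<close> lattice points into \<open>K\<close>, more than
  there are. Hence some functional is shorter than \<open>L\<close>.\<close>

lemma exists_short_general:
  assumes n: "n \<ge> 1" and K: "convex_body n K" and N: "K \<inter> Zn n \<noteq> {}"
  defines "N \<equiv> real (card (K \<inter> Zn n))"
  obtains u \<mu> where "u \<in> int_pts {..<n}" "\<exists>i\<in>{..<n}. u i \<noteq> 0"
    "sqnorm (K \<inter> Zn n) (\<lambda>x. pairing n u x - \<mu>) \<le> N * (8 * (real n)\<^sup>2 * N powr (1 / n))\<^sup>2"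
proof -
  define A where "A = K \<inter> Zn n"
  have fin: "finite A" unfolding A_def by (rule finite_lattice_points[OF K])
  have A0: "A \<noteq> {}" using N by (simp add: A_def)
  have N_card: "N = real (card A)" by (simp add: N_def A_def)
  have N1: "N \<ge> 1" using fin A0 by (simp add: N_card Suc_le_eq card_gt_0_iff)
  have cK: "compact K" "convex K" "K \<subseteq> Rn n" using K by (auto simp: convex_body_def)
  define mean where "mean u = (\<Sum>y\<in>A. pairing n u y) / real (card A)" for u
  define m where "m i = (\<Sum>y\<in>A. Poly_Mapping.lookup y i) / N" for i
  \<comment> \<open>Centering the coordinates and dividing by \<open>sqrt N\<close> makes
    \<open>sqnorm A (comb {..<n} \<phi> u)\<close> the variance of
    \<open>pairing n u\<close>.\<close>
  define \<phi> where "\<phi> i x = (Poly_Mapping.lookup x i - m i) / sqrt N"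
    for i and x :: "nat \<Rightarrow>\<^sub>0 real"
  have comb: "comb {..<n} \<phi> u x = (pairing n u x - mean u) / sqrt N" for u x
  proof -
    have "mean u = (\<Sum>i<n. u i * m i)"
      unfolding mean_def pairing_def N_card m_def
      by (subst sum.swap) (simp add: sum_distrib_left sum_divide_distrib)
    then have "pairing n u x - mean u = (\<Sum>i<n. u i * (Poly_Mapping.lookup x i - m i))"
      by (simp add: pairing_def right_diff_distrib sum_subtractf)
    then show ?thesis by (simp add: comb_def \<phi>_def sum_divide_distrib)
  qed
  have root1: "N powr (1 / n) \<ge> 1" using N1 by (simp add: ge_one_powr_ge_zero)
  \<comment> \<open>The least integer strictly above the n-th root of \<open>N\<close>, so that
    \<open>N < k ^ n\<close>; since the root is at least 1, \<open>k\<close> is at most twice the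
    root.\<close>
  define k where "k = nat \<lfloor>N powr (1 / n)\<rfloor> + 1"
  have k: "N powr (1 / n) < real k" "real k \<le> 2 * N powr (1 / n)" "k \<ge> 1"
    using root1 unfolding k_def by linarith+
  have "N = (N powr (1 / n)) ^ n" using n N1 by (simp add: powr_powr flip: powr_realpow)
  also have "\<dots> < real k ^ n" using k(1) n by (intro power_strict_mono) auto
  finally have small: "card A < k ^ n" unfolding N_card by (metis of_nat_less_iff of_nat_power)
  \<comment> \<open>Chosen so that the side bound \<open>4 * n / L\<close> equals
    \<open>1 / (n * k)\<close>, the size required by
    \<open>power_le_card_lattice_points\<close>.\<close>
  define L where "L = 4 * (real n)\<^sup>2 * real k"
  have L: "L > 0" using n k by (simp add: L_def)
  have c: "4 * real n / L = 1 / (real n * real k)"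
    using n k by (simp add: L_def power2_eq_square)
  have "\<not> min_ge L A \<phi> {..<n}"
  proof
    assume "min_ge L A \<phi> {..<n}"
    then have "box_covers (1 / (real n * real k)) A \<phi> {..<n}"
      using box_covers_of_min_ge[OF fin L, of "{..<n}" n \<phi>] by (simp add: c)
    then obtain f where f: "\<And>j. j < n \<Longrightarrow> sqnorm A (f j) \<le> (1 / (real n * real k))\<^sup>2"
      and cover: "\<And>y. \<exists>z\<in>int_pts {..<n}. \<exists>\<theta>. (\<forall>j\<in>{..<n}. 0 \<le> \<theta> j \<and> \<theta> j \<le> 1) \<and>
        (\<forall>i\<in>{..<n}. y i = z i + (\<Sum>j<n. \<theta> j * (\<Sum>a\<in>A. f j a * \<phi> i a)))"
      unfolding box_covers_def by blast
    have AK: "A \<subseteq> K" by (auto simp: A_def)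
    have c0: "0 < 1 / (real n * real k)" using n k by simp
    define w where "w j i = (\<Sum>a\<in>A. f j a * \<phi> i a)" for j i
    define diff where "diff j p q \<longleftrightarrow> p \<in> K \<and> q \<in> K \<and> (\<forall>i<n. w j i =
        1 / (real n * real k) * (Poly_Mapping.lookup p i - Poly_Mapping.lookup q i))" for j p q
    have "\<exists>p q. diff j p q" if j: "j < n" for j
    proof (rule segment_of_functional[OF cK fin A0 AK N_card c0 f[OF j] comb[unfolded mean_def]])
      fix p q assume "p \<in> K" "q \<in> K" "\<And>i. i < n \<Longrightarrow> (\<Sum>a\<in>A. f j a * \<phi> i a) =
        1 / (real n * real k) * (Poly_Mapping.lookup p i - Poly_Mapping.lookup q i)"
      then have "diff j p q" by (simp add: diff_def w_def)
      then show ?thesis by blast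
    qed
    then obtain p q where pq: "\<And>j. j < n \<Longrightarrow> diff j (p j) (q j)" by metis
    have "k ^ n \<le> card (K \<inter> Zn n)"
    proof (rule power_le_card_lattice_points[OF n K k(3)])
      show "p j \<in> K" "q j \<in> K" if "j < n" for j using pq[OF that] by (auto simp: diff_def)
      show "w j i = 1 / (real n * real k) *
          (Poly_Mapping.lookup (p j) i - Poly_Mapping.lookup (q j) i)" if "i < n" "j < n" for i j
        using pq[OF that(2)] that(1) unfolding diff_def by blast
      show "\<exists>z\<in>int_pts {..<n}. \<exists>\<theta>. (\<forall>j\<in>{..<n}. 0 \<le> \<theta> j \<and> \<theta> j \<le> 1) \<and>
          (\<forall>i\<in>{..<n}. y i = z i + (\<Sum>j<n. \<theta> j * w j i))" for y
        unfolding w_def by (rule cover)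
    qed
    then show False using small by (simp add: A_def)
  qed
  then obtain u where u: "u \<in> int_pts {..<n}" "\<exists>i\<in>{..<n}. u i \<noteq> 0"
    "sqnorm A (comb {..<n} \<phi> u) < L\<^sup>2"
    unfolding min_ge_def by (auto simp: not_le)
  have "L \<le> 8 * (real n)\<^sup>2 * N powr (1 / n)"
    unfolding L_def using mult_left_mono[OF k(2), of "4 * (real n)\<^sup>2"] by simp
  then have "L\<^sup>2 \<le> (8 * (real n)\<^sup>2 * N powr (1 / n))\<^sup>2" using L by (intro power_mono) auto
  moreover have "sqnorm A (comb {..<n} \<phi> u) = sqnorm A (\<lambda>x. pairing n u x - mean u) / N"
    unfolding comb[abs_def] sqnorm_divide using N1 by simp
  ultimately have "sqnorm A (\<lambda>x. pairing n u x - mean u) / N \<le> (8 * (real n)\<^sup>2 * N powr (1 / n))\<^sup>2"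
    using u(3) by linarith
  then have "sqnorm A (\<lambda>x. pairing n u x - mean u) \<le> N * (8 * (real n)\<^sup>2 * N powr (1 / n))\<^sup>2"
    using N1 by (simp add: divide_le_eq mult.commute)
  then show thesis using that u(1,2) by (simp add: A_def)
qed

section \<open>From variance bounds to the theorem\<close>

lemma powr_le_of_variance:
  assumes n: "n \<ge> 1" and K: "convex_body n K" and N0: "K \<inter> Zn n \<noteq> {}"
    and u: "u \<in> int_pts {..<n}" "\<exists>i\<in>{..<n}. u i \<noteq> 0" and C: "C \<ge> 1"
    and var: "sqnorm (K \<inter> Zn n) (\<lambda>x. pairing n u x - \<mu>) \<le>
      real (card (K \<inter> Zn n)) * (C * real (card (K \<inter> Zn n)) powr (1 / n))\<^sup>2"
  shows "real (lattice_count n K) powr ((real n - 1) / real n) \<le> 8 * C * real (max_slice_count n K)"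
proof -
  define N where "N = real (card (K \<inter> Zn n))"
  have N1: "N \<ge> 1"
    using finite_lattice_points[OF K] N0 by (simp add: N_def Suc_le_eq card_gt_0_iff)
  define t where "t = N powr (1 / n)"
  have t1: "t \<ge> 1" using N1 by (simp add: t_def ge_one_powr_ge_zero)
  have "1 * 1 \<le> C * t" using C t1 by (intro mult_mono) auto
  \<comment> \<open>\<open>card_le_slices\<close> with \<open>S = C * t\<close>; dividing by
    \<open>t\<close> then lowers the exponent of \<open>N\<close> from 1 to
    \<open>(n - 1) / n\<close>.\<close>
  then have "N \<le> 8 * (C * t) * real (max_slice_count n K)"
    unfolding N_def using var by (intro card_le_slices[OF K u]) (auto simp: t_def N_def)
  then have "N / t \<le> 8 * C * real (max_slice_count n K)"
    using t1 by (simp add: divide_le_eq mult_ac)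
  moreover have "N powr ((real n - 1) / real n) = N / t"
    using N1 n by (simp add: t_def diff_divide_distrib powr_diff)
  ultimately show ?thesis by (simp add: lattice_count_def N_def)
qed

theorem theorem1p4:
  shows "(\<exists>C::real. C > 0 \<and>
            (\<forall>n::nat. \<forall>K. n \<ge> 1 \<longrightarrow> convex_body n K \<longrightarrow>
              real (lattice_count n K) powr ((real n - 1) / real n)
                \<le> C * (real n)\<^sup>2 * real (max_slice_count n K))) \<and>
         (\<exists>C::real. C > 0 \<and>
            (\<forall>n::nat. \<forall>K. n \<ge> 1 \<longrightarrow> convex_body n K \<longrightarrow> origin_symmetric K \<longrightarrow>
              real (lattice_count n K) powr ((real n - 1) / real n)
                \<le> C * real n * real (max_slice_count n K)))"
proof -
  \<comment> \<open>64 is the factor 8 of \<open>powr_le_of_variance\<close> times the 8 of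
    \<open>exists_short_general\<close>.\<close>
  have general: "real (lattice_count n K) powr ((real n - 1) / real n)
      \<le> 64 * (real n)\<^sup>2 * real (max_slice_count n K)"
    if n: "n \<ge> 1" and K: "convex_body n K" for n K
  proof (cases "K \<inter> Zn n = {}")
    \<comment> \<open>Without lattice points the left side is 0, even for \<open>n = 1\<close>,
      since \<open>0 powr 0\<close> is 0.\<close>
    case True
    then show ?thesis by (simp add: lattice_count_def)
  next
    case False
    have C: "1 \<le> 8 * (real n)\<^sup>2" using n one_le_power[of "real n" 2] by linarith
    show ?thesis
    proof (rule exists_short_general[OF n K False])
      fix u \<mu> assume "u \<in> int_pts {..<n}" "\<exists>i\<in>{..<n}. u i \<noteq> 0"
        "sqnorm (K \<inter> Zn n) (\<lambda>x. pairing n u x - \<mu>) \<le> real (card (K \<inter> Zn n)) *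
          (8 * (real n)\<^sup>2 * real (card (K \<inter> Zn n)) powr (1 / n))\<^sup>2"
      from powr_le_of_variance[OF n K False this(1,2) C this(3)] show ?thesis by simp
    qed
  qed
  \<comment> \<open>Here the factor 8 meets the 2 of \<open>exists_short_symmetric\<close>, and
    deviations are taken about the origin instead of the mean.\<close>
  have symmetric: "real (lattice_count n K) powr ((real n - 1) / real n)
      \<le> 16 * real n * real (max_slice_count n K)"
    if n: "n \<ge> 1" and K: "convex_body n K" "origin_symmetric K" for n K
  proof (cases "K \<inter> Zn n = {}")
    case True
    then show ?thesis by (simp add: lattice_count_def)
  next
    case False
    have C: "1 \<le> 2 * real n" using n by linarith
    show ?thesis
    proof (rule exists_short_symmetric[OF n K False])
      fix u assume u: "u \<in> int_pts {..<n}" "\<exists>i\<in>{..<n}. u i \<noteq> 0"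
        and "sqnorm (K \<inter> Zn n) (pairing n u) \<le> real (card (K \<inter> Zn n)) *
          (2 * real n * real (card (K \<inter> Zn n)) powr (1 / n))\<^sup>2"
      then have "sqnorm (K \<inter> Zn n) (\<lambda>x. pairing n u x - 0) \<le> real (card (K \<inter> Zn n)) *
          (2 * real n * real (card (K \<inter> Zn n)) powr (1 / n))\<^sup>2" by simp
      from powr_le_of_variance[OF n K(1) False u C this] show ?thesis by simp
    qed
  qed
  show ?thesis
  proof (rule conjI, goal_cases)
    case 1
    then show ?case by (rule exI[of _ 64]) (simp add: general)
  next
    case 2
    then show ?case by (rule exI[of _ 16]) (simp add: symmetric)
  qed
qed

end
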